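(* Suppose $X_t=M_t+Y_t$, $t\in[0,\infty)$, where $M$ is a $D$-dimensional continuous $(\mathcal{F}_t)$-local martingale and $Y$ is a $D$-dimensional $(\mathcal{F}_t)$-adapted process. Assume that: (1) for every $K\in\mathbb{N}$ there is a strictly positive random variable $\varepsilon_K$ such that for every $0\le s\le t\le K$, $$\langle M\rangle_t-\langle M\rangle_s\ \ge\ \varepsilon_K\,(t-s)\,\mathbb{I}_D,$$ where $\mathbb{I}_D$ is the $D\times D$ unit matrix; (2) $Y$ is $1/2$-Hölder continuous on compacts, that is, for every $K\in\mathbb{N}$ there is a positive random variable $C_K$ such that for every $0\le s\le t\le K$, $$|Y_t-Y_s|:=\sqrt{\sum_{d=1}^D|Y^d_t-Y^d_s|^2}\ \le\ C_K|t-s|^{1/2}.$$ Then $X$ satisfies (TWC) at bounded stopping times.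
   Context: Setting: $(\Omega,\mathcal{F},(\mathcal{F}_t)_{t\in[0,\infty)},P)$ is a filtered probability space satisfying the usual conditions (completeness and right-continuity). All stopping times are with respect to $(\mathcal{F}_t)$. Processes with values in $\mathbb{R}^D$ are column vectors. $\langle M\rangle_t$ denotes the $D\times D$ matrix of quadratic covariations $(\langle M^d,M^q\rangle_t)_{d,q}$, and $\ge$ between symmetric matrices is the positive semidefinite order. For a stopping time $\sigma$, an $\mathcal{F}_\sigma$-measurable direction is a $D$-dimensional row vector $H$ of $\mathcal{F}_\sigma$-measurable random variables with $|H|=1$ $P$-a.s. (Euclidean norm). (TWC), two-way crossing: for an a.s. finite stopping time $\sigma$ and an $\mathcal{F}_\sigma$-measurable direction $H$ let $\sigma_H=\inf\{t\ge\sigma:\ H(X_t-X_\sigma)>0\}$ (with $\inf\emptyset=\infty$). $X$ satisfies (TWC) at bounded stopping times if $\sigma_H=\sigma_{-H}$ $P$-a.s. for every bounded stopping time $\sigma$ and every $\mathcal{F}_\sigma$-measurable direction $H$. *)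

theory Defs
  imports "HOL-Probability.Probability"
begin

text \<open>
  The library's \<^locale>\<open>filtration\<close> is indexed by a whole linearly ordered type, so time is the type
  \<^typ>\<open>real\<close> and every condition below is restricted to times \<open>t \<ge> 0\<close>. The values of \<open>F\<close> at negative
  times carry no information: a filtration indexed by \<open>[0,\<infinity>)\<close> extends by \<open>F t = F 0\<close> for \<open>t < 0\<close>, and
  all stopping times below are nonnegative.
\<close>

locale usual_filtered_prob_space =
  prob_space P + complete_measure P + filtration "space P" F
  for P :: "'a measure" and F :: "real \<Rightarrow> 'a measure" +
  assumes sets_F_subset: "sets (F t) \<subseteq> sets P"
    and null_sets_F: "null_sets P \<subseteq> sets (F 0)"
    and right_continuous_F: "0 \<le> t \<Longrightarrow> sets (F t) = (\<Inter>s\<in>{t<..}. sets (F s))"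

definition adapted :: "(real \<Rightarrow> 'a measure) \<Rightarrow> (real \<Rightarrow> 'a \<Rightarrow> 'b::topological_space) \<Rightarrow> bool" where
  "adapted F Z \<longleftrightarrow> (\<forall>t\<ge>0. Z t \<in> borel_measurable (F t))"

definition martingale :: "'a measure \<Rightarrow> (real \<Rightarrow> 'a measure) \<Rightarrow> (real \<Rightarrow> 'a \<Rightarrow> real) \<Rightarrow> bool" where
  "martingale P F Z \<longleftrightarrow>
     adapted F Z \<and> (\<forall>t\<ge>0. integrable P (Z t)) \<and>
     (\<forall>s t. 0 \<le> s \<and> s \<le> t \<longrightarrow> (AE \<omega> in P. real_cond_exp P (F s) (Z t) \<omega> = Z s \<omega>))"

text \<open>
  Stopping times with values in \<open>[0,\<infinity>]\<close>; the library's \<^const>\<open>stopping_time\<close> requires the values to lie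
  in the index type of the filtration.
\<close>

definition ext_stopping_time :: "'a measure \<Rightarrow> (real \<Rightarrow> 'a measure) \<Rightarrow> ('a \<Rightarrow> ereal) \<Rightarrow> bool" where
  "ext_stopping_time P F \<tau> \<longleftrightarrow>
     (\<forall>\<omega>\<in>space P. 0 \<le> \<tau> \<omega>) \<and> (\<forall>t\<ge>0. Measurable.pred (F t) (\<lambda>\<omega>. \<tau> \<omega> \<le> ereal t))"

lemma (in usual_filtered_prob_space) ext_stopping_time_ereal_iff:
  assumes "\<And>\<omega>. \<omega> \<in> space P \<Longrightarrow> 0 \<le> \<sigma> \<omega>"
  shows "ext_stopping_time P F (\<lambda>\<omega>. ereal (\<sigma> \<omega>)) \<longleftrightarrow> stopping_time F \<sigma>"
proof -
  have "Measurable.pred (F t) (\<lambda>\<omega>. \<sigma> \<omega> \<le> t)" if "t < 0" for t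
  proof -
    have "{\<omega> \<in> space (F t). \<sigma> \<omega> \<le> t} = {}"
      using assms that by (force simp: space_F)
    then show ?thesis
      unfolding pred_def by (simp only: sets.empty_sets)
  qed
  then have "(\<forall>t\<ge>0. Measurable.pred (F t) (\<lambda>\<omega>. \<sigma> \<omega> \<le> t)) \<longleftrightarrow> stopping_time F \<sigma>"
    unfolding stopping_time_def using not_less by blast
  then show ?thesis
    using assms by (simp add: ext_stopping_time_def)
qed

definition stopped :: "('a \<Rightarrow> ereal) \<Rightarrow> (real \<Rightarrow> 'a \<Rightarrow> 'b) \<Rightarrow> real \<Rightarrow> 'a \<Rightarrow> 'b" where
  "stopped \<tau> Z t \<omega> = Z (real_of_ereal (min (ereal t) (\<tau> \<omega>))) \<omega>"

text \<open>The initial value is subtracted because it need not be integrable.\<close>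

definition continuous_local_martingale ::
    "'a measure \<Rightarrow> (real \<Rightarrow> 'a measure) \<Rightarrow> (real \<Rightarrow> 'a \<Rightarrow> real) \<Rightarrow> bool" where
  "continuous_local_martingale P F Z \<longleftrightarrow>
     adapted F Z \<and>
     (AE \<omega> in P. continuous_on {0..} (\<lambda>t. Z t \<omega>)) \<and>
     (\<exists>\<tau>. (\<forall>n::nat. ext_stopping_time P F (\<tau> n)) \<and>
          (AE \<omega> in P. incseq (\<lambda>n. \<tau> n \<omega>) \<and> (\<lambda>n. \<tau> n \<omega>) \<longlonglongrightarrow> \<infinity>) \<and>
          (\<forall>n. martingale P F (\<lambda>t \<omega>. stopped (\<tau> n) Z t \<omega> - Z 0 \<omega>)))"

definition finite_variation_on_compacts :: "(real \<Rightarrow> real) \<Rightarrow> bool" where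
  "finite_variation_on_compacts f \<longleftrightarrow>
     (\<forall>T\<ge>0. \<exists>B. \<forall>n (p::nat \<Rightarrow> real).
        mono p \<and> range p \<subseteq> {0..T} \<longrightarrow> (\<Sum>i<n. \<bar>f (p (Suc i)) - f (p i)\<bar>) \<le> B)"

text \<open>
  \<open>A\<close> is a version of \<open>\<langle>M, N\<rangle>\<close>, the process, unique up to indistinguishability, with these properties.
\<close>

definition quadratic_covariation ::
    "'a measure \<Rightarrow> (real \<Rightarrow> 'a measure) \<Rightarrow> (real \<Rightarrow> 'a \<Rightarrow> real) \<Rightarrow> (real \<Rightarrow> 'a \<Rightarrow> real) \<Rightarrow>
     (real \<Rightarrow> 'a \<Rightarrow> real) \<Rightarrow> bool" where
  "quadratic_covariation P F M N A \<longleftrightarrow>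
     adapted F A \<and>
     (AE \<omega> in P. A 0 \<omega> = 0 \<and> continuous_on {0..} (\<lambda>t. A t \<omega>) \<and>
                 finite_variation_on_compacts (\<lambda>t. A t \<omega>)) \<and>
     continuous_local_martingale P F (\<lambda>t \<omega>. M t \<omega> * N t \<omega> - A t \<omega>)"

text \<open>The positive semidefinite order; it is used for symmetric matrices only.\<close>

definition psd_le :: "real^'d^'d \<Rightarrow> real^'d^'d \<Rightarrow> bool" where
  "psd_le A B \<longleftrightarrow> (\<forall>v. 0 \<le> v \<bullet> ((B - A) *v v))"

definition measurable_direction ::
    "'a measure \<Rightarrow> (real \<Rightarrow> 'a measure) \<Rightarrow> ('a \<Rightarrow> real) \<Rightarrow> ('a \<Rightarrow> real^'d) \<Rightarrow> bool" where
  "measurable_direction P F \<sigma> H \<longleftrightarrow>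
     H \<in> borel_measurable (filtration.pre_sigma (space P) F \<sigma>) \<and> (AE \<omega> in P. norm (H \<omega>) = 1)"

text \<open>The infimum is taken in \<^typ>\<open>ereal\<close>, where \<open>Inf {} = \<infinity>\<close>.\<close>

definition crossing_time ::
    "(real \<Rightarrow> 'a \<Rightarrow> real^'d) \<Rightarrow> ('a \<Rightarrow> real) \<Rightarrow> ('a \<Rightarrow> real^'d) \<Rightarrow> 'a \<Rightarrow> ereal" where
  "crossing_time X \<sigma> H \<omega> = Inf {ereal t | t. \<sigma> \<omega> \<le> t \<and> H \<omega> \<bullet> (X t \<omega> - X (\<sigma> \<omega>) \<omega>) > 0}"

definition twc_at_bounded_stopping_times ::
    "'a measure \<Rightarrow> (real \<Rightarrow> 'a measure) \<Rightarrow> (real \<Rightarrow> 'a \<Rightarrow> real^'d) \<Rightarrow> bool" where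
  "twc_at_bounded_stopping_times P F X \<longleftrightarrow>
     (\<forall>\<sigma> H. stopping_time F \<sigma> \<and> (\<exists>K. \<forall>\<omega>\<in>space P. 0 \<le> \<sigma> \<omega> \<and> \<sigma> \<omega> \<le> K) \<and>
            measurable_direction P F \<sigma> H \<longrightarrow>
            (AE \<omega> in P. crossing_time X \<sigma> H \<omega> = crossing_time X \<sigma> (\<lambda>\<omega>. - H \<omega>) \<omega>))"

end

theory Submission
  imports Defs
begin

text \<open>The constants \<epsilon> and C of the hypotheses are random and need not be known at
  time \<sigma>, so no stopping time can be built from them. This is why N is measured against its
  own clock with a deterministic factor c: all times and events of the main argument are then
  compatible with the filtration. The random constants return only at the very end, path by path,
  through a natural number c with C \<le> c sqrt \<epsilon>; one null set serves all natural c. The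
  contradiction is run on the event that the first time at which N exceeds c sqrt a comes strictly
  after \<sigma>. This event is already decided at \<sigma>, so restricting to it keeps the
  increments of N and of the compensated square centred. The whole step estimate is one quadratic
  inequality in the rescaled increments, integrated over such an event. Local martingales need not
  be integrable at stopping times, but every integral is taken over an event on which the localizing
  times are not yet reached and all components are bounded.\<close>

text \<open>
  Both crossing times equal \<open>\<sigma>\<close> almost surely. Put \<open>N t = H \<bullet> (M t - M \<sigma>)\<close> and let \<open>a\<close> be its bracket, so
  that \<open>a t \<ge> \<epsilon> (t - \<sigma>)\<close>. It suffices that, for every constant \<open>c\<close>, \<open>N\<close> exceeds \<open>c sqrt a\<close> at times
  arbitrarily close to \<open>\<sigma>\<close>: then \<open>N\<close> beats the increments of \<open>Y\<close>, which are at most \<open>C sqrt (t - \<sigma>)\<close>.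

  Instead of a time change to Brownian motion and the law of the iterated logarithm, second moments
  are used. Run \<open>N\<close> from a stopping time \<open>S\<close> until \<open>N\<close> has moved by \<open>2 sqrt r\<close> or \<open>a\<close> has grown by \<open>r\<close>.
  As \<open>N\<close> and \<open>N\<^sup>2 - a\<close> have centred increments, \<open>N\<close> has then grown by at least \<open>sqrt r / 16\<close> with
  conditional probability bounded below. After \<open>m\<close> such steps \<open>N \<ge> m sqrt r / 16\<close> while \<open>a \<le> m r\<close>, with
  probability bounded below independently of \<open>r\<close>; for \<open>sqrt m > 16 c\<close> this contradicts \<open>N \<le> c sqrt a\<close>.
  Letting \<open>r\<close> tend to \<open>0\<close> makes the event that the clock \<open>a\<close> runs out during these steps negligible.
\<close>

section \<open>Stopping times and continuous adapted processes\<close>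

context usual_filtered_prob_space
begin

section \<open>Measurability at fixed times and at stopping times\<close>

lemma subalgebra_F: "subalgebra P (F t)"
  using sets_F_subset space_F by (simp add: subalgebra_def)

lemma measurable_F_imp_P: "f \<in> measurable (F t) N \<Longrightarrow> f \<in> measurable P N"
  by (rule measurable_from_subalg[OF subalgebra_F])

lemma measurable_F_mono:
  assumes "f \<in> measurable (F s) N" "s \<le> t"
  shows "f \<in> measurable (F t) N"
  using assms sets_F_mono[of s t]
  by (intro measurable_from_subalg[of "F t" "F s"]) (auto simp: subalgebra_def space_F)

lemma subalgebra_pre_sigma:
  assumes T: "stopping_time F T"
  shows "subalgebra P (pre_sigma T)"
  unfolding subalgebra_def
proof safe
  fix A assume A: "A \<in> sets (pre_sigma T)"
  have sub: "A \<subseteq> space P"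
    using sets.sets_into_space[OF A] by (simp add: space_pre_sigma)
  have "{\<omega>\<in>A. T \<omega> \<le> real n} \<in> sets P" for n :: nat
    using sets_pre_sigmaD[OF T A] sets_F_subset by blast
  then have "(\<Union>n::nat. {\<omega>\<in>A. T \<omega> \<le> real n}) \<in> sets P" by blast
  also have "(\<Union>n::nat. {\<omega>\<in>A. T \<omega> \<le> real n}) = A"
    using real_arch_simple by auto
  finally show "A \<in> sets P" .
qed (auto simp: space_pre_sigma)

lemma pre_sigma_imp_P:
  "stopping_time F T \<Longrightarrow> f \<in> measurable (pre_sigma T) N \<Longrightarrow> f \<in> measurable P N"
  by (rule measurable_from_subalg[OF subalgebra_pre_sigma])

lemma pre_sigma_mono:
  assumes "stopping_time F S" "stopping_time F T" "\<And>\<omega>. \<omega> \<in> space P \<Longrightarrow> S \<omega> \<le> T \<omega>"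
    and "f \<in> measurable (pre_sigma S) N"
  shows "f \<in> measurable (pre_sigma T) N"
  using assms mono_pre_sigma[of S T]
  by (intro measurable_from_subalg[of "pre_sigma T" "pre_sigma S"])
     (auto simp: subalgebra_def space_pre_sigma)

lemma pre_sigma_restrict_measurable:
  fixes g :: "'a \<Rightarrow> real"
  assumes T: "stopping_time F T" and g: "g \<in> borel_measurable (pre_sigma T)"
  shows "(\<lambda>\<omega>. if T \<omega> \<le> t then g \<omega> else 0) \<in> borel_measurable (F t)"
proof (rule borel_measurableI_le)
  fix y :: real
  have A: "{\<omega> \<in> space (pre_sigma T). g \<omega> \<le> y} \<in> sets (pre_sigma T)"
    using g by measurable
  have 1: "{\<omega> \<in> space P. g \<omega> \<le> y \<and> T \<omega> \<le> t} \<in> sets (F t)"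
    using sets_pre_sigmaD[OF T A, of t] by (simp add: space_pre_sigma)
  have 2: "{\<omega> \<in> space P. \<not> T \<omega> \<le> t \<and> 0 \<le> y} \<in> sets (F t)"
    using stopping_timeD2[OF T, of t] unfolding pred_def by (cases "0 \<le> y") (auto simp: space_F not_le)
  have "{\<omega> \<in> space (F t). (if T \<omega> \<le> t then g \<omega> else 0) \<le> y}
      = {\<omega> \<in> space P. g \<omega> \<le> y \<and> T \<omega> \<le> t} \<union> {\<omega> \<in> space P. \<not> T \<omega> \<le> t \<and> 0 \<le> y}"
    by (auto simp: space_F)
  with 1 2 show "{\<omega> \<in> space (F t). (if T \<omega> \<le> t then g \<omega> else 0) \<le> y} \<in> sets (F t)" by auto
qed

text \<open>An event belongs to \<open>pre_sigma T\<close> as soon as its traces on {T \<le> t} lie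
  in \<open>F t\<close>. So for each t separately \<open>g\<close> may be replaced by any
  \<open>F t\<close>-measurable function that agrees with it there; the intended one is a process
  evaluated at the minimum of t and T.\<close>

lemma measurable_pre_sigmaI:
  fixes g :: "'a \<Rightarrow> real"
  assumes T: "stopping_time F T" and "\<And>\<omega>. \<omega> \<in> space P \<Longrightarrow> 0 \<le> T \<omega>"
    and g: "\<And>t. 0 \<le> t \<Longrightarrow> \<exists>h\<in>borel_measurable (F t). \<forall>\<omega>\<in>space P. T \<omega> \<le> t \<longrightarrow> g \<omega> = h \<omega>"
  shows "g \<in> borel_measurable (pre_sigma T)"
proof (intro borel_measurableI_le sets_pre_sigmaI[OF T])
  fix y t :: real
  show "{\<omega> \<in> {\<omega> \<in> space (pre_sigma T). g \<omega> \<le> y}. T \<omega> \<le> t} \<in> sets (F t)"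
  proof (cases "0 \<le> t")
    case True
    then obtain h where h: "h \<in> borel_measurable (F t)"
      "\<And>\<omega>. \<omega> \<in> space P \<Longrightarrow> T \<omega> \<le> t \<Longrightarrow> g \<omega> = h \<omega>" using g by blast
    have "{\<omega> \<in> space (F t). h \<omega> \<le> y} \<inter> {\<omega> \<in> space (F t). T \<omega> \<le> t} \<in> sets (F t)"
      using h(1) stopping_timeD[OF T, of t] unfolding pred_def by auto
    also have "{\<omega> \<in> space (F t). h \<omega> \<le> y} \<inter> {\<omega> \<in> space (F t). T \<omega> \<le> t} = {\<omega> \<in> {\<omega> \<in> space (pre_sigma T). g \<omega> \<le> y}. T \<omega> \<le> t}"
      using h(2) by (auto simp: space_F space_pre_sigma)
    finally show ?thesis .
  next
    case False
    then have "{\<omega> \<in> {\<omega> \<in> space (pre_sigma T). g \<omega> \<le> y}. T \<omega> \<le> t} = {}"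
      using assms(2) by (force simp: space_pre_sigma)
    then show ?thesis by (simp only: sets.empty_sets)
  qed
qed

text \<open>Continuity is asked of every path, so that evaluation at stopping times and the
  hitting-time facts below hold on all of \<open>space P\<close>. The processes of the theorem,
  continuous only almost surely, are brought into this form at the end by setting them to 0 off an
  almost sure event.\<close>

definition cont_adapted :: "(real \<Rightarrow> 'a \<Rightarrow> real) \<Rightarrow> bool" where
  "cont_adapted Z \<longleftrightarrow> adapted F Z \<and> (\<forall>\<omega>\<in>space P. continuous_on {0..} (\<lambda>t. Z t \<omega>))"

lemma cont_adaptedD:
  assumes "cont_adapted Z"
  shows "0 \<le> t \<Longrightarrow> Z t \<in> borel_measurable (F t)"
    and "\<omega> \<in> space P \<Longrightarrow> continuous_on {0..} (\<lambda>t. Z t \<omega>)"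
  using assms by (auto simp: cont_adapted_def adapted_def)

text \<open>With the floor plus one, the level sets of \<open>grid_above n T\<close> are the events
  {i / (n+1) \<le> T < (i+1) / (n+1)}, each decided at the time (i+1) / (n+1) that is the value
  taken on it.\<close>

definition grid_above :: "nat \<Rightarrow> real \<Rightarrow> real" where
  "grid_above n s = (of_int \<lfloor>real (Suc n) * s\<rfloor> + 1) / real (Suc n)"

lemma less_grid_above: "s < grid_above n s"
  unfolding grid_above_def
  using floor_correct[of "real (Suc n) * s"] by (simp add: pos_less_divide_eq mult.commute del: of_nat_Suc)

lemma grid_above_le: "grid_above n s \<le> s + 1 / real (Suc n)"
proof -
  have "grid_above n s \<le> (real (Suc n) * s + 1) / real (Suc n)"
    unfolding grid_above_def by (intro divide_right_mono add_right_mono of_int_floor_le) auto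
  also have "\<dots> = s + 1 / real (Suc n)" by (simp add: field_simps)
  finally show ?thesis .
qed

lemma grid_above_tendsto: "(\<lambda>n. grid_above n s) \<longlonglongrightarrow> s"
proof (rule tendsto_sandwich[OF _ _ tendsto_const])
  show "(\<lambda>n. s + 1 / real (Suc n)) \<longlonglongrightarrow> s"
    using tendsto_add[OF tendsto_const[of s] LIMSEQ_inverse_real_of_nat] by (simp add: inverse_eq_divide)
qed (use less_grid_above less_imp_le grid_above_le in \<open>blast intro: always_eventually\<close>)+

text \<open>A grid time has countably many values, so the process can be evaluated there value by
  value. Approximation from above could look beyond t; capping the grid time at t prevents this and
  keeps the limit.\<close>

lemma cont_adapted_stopped_measurable:
  assumes Z: "cont_adapted Z" and S: "stopping_time F S" and S0: "\<And>\<omega>. \<omega> \<in> space P \<Longrightarrow> 0 \<le> S \<omega>"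
    and t: "0 \<le> t"
  shows "(\<lambda>\<omega>. Z (min t (S \<omega>)) \<omega>) \<in> borel_measurable (F t)"
proof (rule borel_measurable_LIMSEQ_real)
  show "(\<lambda>n. Z (min t (grid_above n (min t (S \<omega>)))) \<omega>) \<longlonglongrightarrow> Z (min t (S \<omega>)) \<omega>" if "\<omega> \<in> space (F t)" for \<omega>
  proof -
    have \<omega>: "\<omega> \<in> space P" using that by (simp add: space_F)
    have s: "0 \<le> min t (S \<omega>)" using S0[OF \<omega>] t by simp
    have "(\<lambda>n. min t (grid_above n (min t (S \<omega>)))) \<longlonglongrightarrow> min t (min t (S \<omega>))"
      by (intro tendsto_min tendsto_const grid_above_tendsto)
    then have 1: "(\<lambda>n. min t (grid_above n (min t (S \<omega>)))) \<longlonglongrightarrow> min t (S \<omega>)" by simp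
    have "0 \<le> grid_above n (min t (S \<omega>))" for n
      using less_grid_above[of "min t (S \<omega>)" n] s by linarith
    with t have "\<forall>\<^sub>F n in sequentially. min t (grid_above n (min t (S \<omega>))) \<in> {0..}"
      by (intro always_eventually) simp
    then show ?thesis
      using s by (intro continuous_on_tendsto_compose[OF cont_adaptedD(2)[OF Z \<omega>] 1]) auto
  qed
  show "(\<lambda>\<omega>. Z (min t (grid_above n (min t (S \<omega>)))) \<omega>) \<in> borel_measurable (F t)" for n
  proof -
    have m: "(\<lambda>\<omega>. min t (S \<omega>)) \<in> borel_measurable (F t)"
    proof (rule borel_measurableI_le)
      fix y
      have "{\<omega> \<in> space (F t). S \<omega> \<le> y} \<in> sets (F t)" if "y < t"
        using stopping_time_le_const[OF S, of y t] that unfolding pred_def by simp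
      then show "{\<omega> \<in> space (F t). min t (S \<omega>) \<le> y} \<in> sets (F t)"
        by (cases "y < t") (auto simp: min_le_iff_disj)
    qed
    have g: "(\<lambda>\<omega>. \<lfloor>real (Suc n) * min t (S \<omega>)\<rfloor>) \<in> measurable (F t) (count_space UNIV)"
      using m by measurable
    \<comment> \<open>The countable family ranges over all integers i, and \<open>max 0\<close>
      makes each of its times nonnegative; at the values actually taken it changes nothing.\<close>
    have f: "(\<lambda>\<omega>. Z (max 0 (min t ((of_int i + 1) / real (Suc n)))) \<omega>) \<in> borel_measurable (F t)" for i
      using t by (intro measurable_F_mono[OF cont_adaptedD(1)[OF Z]]) auto
    have "(\<lambda>\<omega>. Z (max 0 (min t (grid_above n (min t (S \<omega>))))) \<omega>) \<in> borel_measurable (F t)"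
      unfolding grid_above_def using measurable_compose_countable[OF f g] .
    also have "?this \<longleftrightarrow> ?thesis"
    proof (rule measurable_cong)
      fix \<omega> assume "\<omega> \<in> space (F t)"
      then have "max 0 (min t (grid_above n (min t (S \<omega>)))) = min t (grid_above n (min t (S \<omega>)))"
        using less_grid_above[of "min t (S \<omega>)" n] S0[of \<omega>] t unfolding space_F by linarith
      then show "Z (max 0 (min t (grid_above n (min t (S \<omega>))))) \<omega> = Z (min t (grid_above n (min t (S \<omega>)))) \<omega>"
        by (rule arg_cong)
    qed
    finally show ?thesis .
  qed
qed

lemma cont_adapted_at_stopping_time:
  assumes Z: "cont_adapted Z" and S: "stopping_time F S" and S0: "\<And>\<omega>. \<omega> \<in> space P \<Longrightarrow> 0 \<le> S \<omega>"
  shows "(\<lambda>\<omega>. Z (S \<omega>) \<omega>) \<in> borel_measurable (pre_sigma S)"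
proof (rule measurable_pre_sigmaI[OF S S0])
  fix t :: real assume "0 \<le> t"
  then show "\<exists>h\<in>borel_measurable (F t). \<forall>\<omega>\<in>space P. S \<omega> \<le> t \<longrightarrow> Z (S \<omega>) \<omega> = h \<omega>"
    by (intro bexI[OF _ cont_adapted_stopped_measurable[OF Z S S0]]) (auto simp: min_def)
qed

lemma cont_adapted_stopped:
  assumes Z: "cont_adapted Z" and S: "stopping_time F S" and S0: "\<And>\<omega>. \<omega> \<in> space P \<Longrightarrow> 0 \<le> S \<omega>"
  shows "cont_adapted (\<lambda>t \<omega>. Z (min t (S \<omega>)) \<omega>)"
proof -
  have "continuous_on {0..} (\<lambda>t. Z (min t (S \<omega>)) \<omega>)" if "\<omega> \<in> space P" for \<omega>
    using S0[OF that]
    by (intro continuous_on_compose2[OF cont_adaptedD(2)[OF Z that]] continuous_intros) auto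
  then show ?thesis
    using cont_adapted_stopped_measurable[OF assms] by (auto simp: cont_adapted_def adapted_def)
qed

text \<open>This is where right-continuity of the filtration enters: for every s > t the event {T
  \<le> t} is the intersection of the events {T < t + (s - t) / (n+1)}, all of which lie in
  \<open>F s\<close>. Hitting times are naturally controlled through strict inequalities
  only.\<close>

lemma stopping_time_if_less:
  assumes "\<And>\<omega>. \<omega> \<in> space P \<Longrightarrow> 0 \<le> T \<omega>"
    and "\<And>t. 0 < t \<Longrightarrow> Measurable.pred (F t) (\<lambda>\<omega>. T \<omega> < t)"
  shows "stopping_time F T"
proof (rule stopping_timeI)
  fix t :: real
  show "Measurable.pred (F t) (\<lambda>\<omega>. T \<omega> \<le> t)"
  proof (cases "0 \<le> t")
    case True
    have "{\<omega> \<in> space P. T \<omega> \<le> t} \<in> sets (F s)" if s: "t < s" for s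
    proof -
      have m: "{\<omega> \<in> space P. T \<omega> < t + (s - t) / real (Suc n)} \<in> sets (F s)" for n
      proof -
        have *: "0 \<le> (s - t) * real n" using s by simp
        have "0 < t + (s - t) / real (Suc n)" using True s by (simp add: add_nonneg_pos)
        then have "{\<omega> \<in> space P. T \<omega> < t + (s - t) / real (Suc n)} \<in> sets (F (t + (s - t) / real (Suc n)))"
          using assms(2) unfolding pred_def space_F by blast
        moreover have "t + (s - t) / real (Suc n) \<le> s"
          using s * by (simp add: field_simps)
        ultimately show ?thesis using sets_F_mono by blast
      qed
      have "T \<omega> \<le> t" if "\<And>n. T \<omega> < t + (s - t) / real (Suc n)" for \<omega>
      proof (rule LIMSEQ_le_const)
        show "(\<lambda>n. t + (s - t) / real (Suc n)) \<longlonglongrightarrow> t"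
          using tendsto_add[OF tendsto_const[of t] tendsto_mult[OF tendsto_const[of "s - t"] LIMSEQ_inverse_real_of_nat]]
          by (simp add: divide_inverse)
      qed (use that less_imp_le in blast)
      moreover have "0 < (s - t) / real (Suc n)" for n using s by simp
      ultimately have "{\<omega> \<in> space P. T \<omega> \<le> t} = (\<Inter>n. {\<omega> \<in> space P. T \<omega> < t + (s - t) / real (Suc n)})"
        by (force intro: le_less_trans)
      also have "\<dots> \<in> sets (F s)" using m by (intro sets.countable_INT) auto
      finally show ?thesis .
    qed
    then show ?thesis unfolding pred_def space_F right_continuous_F[OF True] by blast
  next
    case False
    then have "{\<omega> \<in> space (F t). T \<omega> \<le> t} = {}" using assms(1) by (force simp: space_F)
    then show ?thesis unfolding pred_def by (simp only: sets.empty_sets)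
  qed
qed

text \<open>
  Only rational times are inspected, so this is a stopping time for every adapted process.
  Times from the horizon \<open>K\<close> on are ignored.
\<close>

definition hit :: "(real \<Rightarrow> 'a \<Rightarrow> real) \<Rightarrow> real \<Rightarrow> real \<Rightarrow> 'a \<Rightarrow> real" where
  "hit f c K \<omega> = Inf (insert K {q \<in> \<rat>. 0 \<le> q \<and> q < K \<and> c < f q \<omega>})"

lemma hit_bounds:
  assumes "0 \<le> K" shows "0 \<le> hit f c K \<omega>" "hit f c K \<omega> \<le> K"
proof -
  show "0 \<le> hit f c K \<omega>"
    unfolding hit_def by (rule cInf_greatest) (use assms in auto)
  show "hit f c K \<omega> \<le> K"
    unfolding hit_def by (intro cInf_lower bdd_belowI[of _ 0]) (use assms in auto)
qed

lemma hit_less_iff: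
  assumes "0 \<le> K"
  shows "hit f c K \<omega> < t \<longleftrightarrow> K < t \<or> (\<exists>q\<in>\<rat>. 0 \<le> q \<and> q < K \<and> q < t \<and> c < f q \<omega>)"
proof -
  have "bdd_below (insert K {q \<in> \<rat>. 0 \<le> q \<and> q < K \<and> c < f q \<omega>})"
    by (rule bdd_belowI[of _ 0]) (use assms in auto)
  then show ?thesis unfolding hit_def by (subst cInf_less_iff) auto
qed

lemma stopping_time_hit:
  assumes f: "adapted F f" and K: "0 \<le> K"
  shows "stopping_time F (hit f c K)"
proof (rule stopping_time_if_less)
  fix t :: real
  have "Measurable.pred (F t) (\<lambda>\<omega>. c < f q \<omega>)" if "q \<in> \<rat>" "0 \<le> q" "q < K" "q < t" for q
  proof -
    have "f q \<in> borel_measurable (F t)"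
      using f that by (auto simp: adapted_def intro: measurable_F_mono[of "f q" q])
    then show ?thesis by measurable
  qed
  then have m: "Measurable.pred (F t) (\<lambda>\<omega>. \<exists>q\<in>{q\<in>\<rat>. 0 \<le> q \<and> q < K \<and> q < t}. c < f q \<omega>)"
    by (intro measurable_pred_countable) (auto intro!: countable_Collect countable_rat)
  then have "Measurable.pred (F t) (\<lambda>\<omega>. K < t \<or> (\<exists>q\<in>{q\<in>\<rat>. 0 \<le> q \<and> q < K \<and> q < t}. c < f q \<omega>))"
    by measurable
  then show "Measurable.pred (F t) (\<lambda>\<omega>. hit f c K \<omega> < t)"
    unfolding hit_less_iff[OF K] by (rule back_subst[of "Measurable.pred (F t)"]) blast
qed (use K hit_bounds in auto)

text \<open>Inspecting rational times loses nothing on a continuous path: a value above c at s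
  persists slightly to the right of s, hence at a rational time still before the hitting
  time.\<close>

lemma not_above_before_hit:
  assumes f: "continuous_on {0..} (\<lambda>t. f t \<omega>)" and K: "0 \<le> K"
    and s: "0 \<le> s" "s < hit f c K \<omega>"
  shows "f s \<omega> \<le> c"
proof (rule ccontr)
  assume "\<not> f s \<omega> \<le> c"
  then have c: "c < f s \<omega>" by simp
  have "((\<lambda>t. f t \<omega>) \<longlongrightarrow> f s \<omega>) (at s within {0..})"
    using f s(1) by (auto simp: continuous_on_def)
  then have "\<forall>\<^sub>F t in at s within {0..}. c < f t \<omega>" using c by (rule order_tendstoD)
  then obtain d where d: "0 < d" "\<And>t. 0 \<le> t \<Longrightarrow> t \<noteq> s \<Longrightarrow> dist t s < d \<Longrightarrow> c < f t \<omega>"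
    by (auto simp: eventually_at)
  obtain q where q: "q \<in> \<rat>" "s < q" "q < min (s + d) (hit f c K \<omega>)"
    using Rats_dense_in_real[of s "min (s + d) (hit f c K \<omega>)"] d(1) s(2) by auto
  have "c < f q \<omega>" using q s(1) by (intro d(2)) (auto simp: dist_real_def)
  then have "hit f c K \<omega> < hit f c K \<omega>"
    using q s(1) hit_bounds(2)[OF K, of f c \<omega>] hit_less_iff[OF K, of f c \<omega> "hit f c K \<omega>"] by force
  then show False by simp
qed

text \<open>The bound before the hitting time passes to the left limit. At time 0 there is no left
  limit, which the disjunction in the hypothesis accounts for.\<close>

lemma not_above_at_hit:
  assumes f: "continuous_on {0..} (\<lambda>t. f t \<omega>)" and K: "0 \<le> K"
    and s: "f 0 \<omega> \<le> c \<or> 0 < hit f c K \<omega>"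
  shows "f (hit f c K \<omega>) \<omega> \<le> c"
proof (cases "hit f c K \<omega> = 0")
  case False
  let ?T = "hit f c K \<omega>"
  have T: "0 < ?T" using False hit_bounds(1)[OF K, of f c \<omega>] by simp
  have "((\<lambda>t. f t \<omega>) \<longlongrightarrow> f ?T \<omega>) (at ?T within {0..})"
    using f T by (auto simp: continuous_on_def)
  then have "((\<lambda>t. f t \<omega>) \<longlongrightarrow> f ?T \<omega>) (at ?T within {0..<?T})"
    by (rule tendsto_within_subset) auto
  moreover have "\<forall>\<^sub>F t in at ?T within {0..<?T}. f t \<omega> \<le> c"
    using not_above_before_hit[where f=f, OF f K] by (auto simp: eventually_at_filter intro!: always_eventually)
  moreover have "at ?T within {0..<?T} \<noteq> bot"
    using T by (simp add: at_within_eq_bot_iff)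
  ultimately show ?thesis by (intro tendsto_upperbound)
qed (use s in auto)

text \<open>If the value were below c, it would stay below c for a while to the right, but the
  infimum forces rational times above c arbitrarily close. The strict inequality with
  \<open>K\<close> excludes that the hitting time is merely the default value.\<close>

lemma not_below_at_hit:
  assumes f: "continuous_on {0..} (\<lambda>t. f t \<omega>)" and K: "0 \<le> K" and less: "hit f c K \<omega> < K"
  shows "c \<le> f (hit f c K \<omega>) \<omega>"
proof (rule ccontr)
  let ?T = "hit f c K \<omega>"
  assume "\<not> c \<le> f ?T \<omega>"
  then have c: "f ?T \<omega> < c" by simp
  have T0: "0 \<le> ?T" using hit_bounds(1)[OF K] .
  have "((\<lambda>t. f t \<omega>) \<longlongrightarrow> f ?T \<omega>) (at ?T within {0..})"
    using f T0 by (auto simp: continuous_on_def)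
  then have "\<forall>\<^sub>F t in at ?T within {0..}. f t \<omega> < c" using c by (rule order_tendstoD)
  then obtain d where d: "0 < d" "\<And>t. 0 \<le> t \<Longrightarrow> t \<noteq> ?T \<Longrightarrow> dist t ?T < d \<Longrightarrow> f t \<omega> < c"
    by (auto simp: eventually_at)
  have "?T < min K (?T + d)" using less d(1) by simp
  then obtain q where q: "0 \<le> q" "q < min K (?T + d)" "q < K" "c < f q \<omega>" "q \<in> \<rat>"
    unfolding hit_less_iff[OF K] by auto
  then have "?T \<le> q"
    unfolding hit_def by (intro cInf_lower bdd_belowI[of _ 0]) (use K in auto)
  then have "f q \<omega> < c" using q c d(2)[of q] by (cases "q = ?T") (auto simp: dist_real_def)
  with q show False by simp
qed

section \<open>Optional stopping\<close>

lemma martingale_integral_eq: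
  assumes Z: "martingale P F Z" and st: "0 \<le> s" "s \<le> t"
    and g: "g \<in> borel_measurable (F s)" and C: "\<And>\<omega>. \<omega> \<in> space P \<Longrightarrow> \<bar>g \<omega>\<bar> \<le> C"
  shows "integrable P (\<lambda>\<omega>. g \<omega> * Z t \<omega>)"
    and "(\<integral>\<omega>. g \<omega> * Z s \<omega> \<partial>P) = (\<integral>\<omega>. g \<omega> * Z t \<omega> \<partial>P)"
proof -
  have int: "integrable P (Z t)" and cond: "AE \<omega> in P. real_cond_exp P (F s) (Z t) \<omega> = Z s \<omega>"
    using Z st by (auto simp: martingale_def)
  have gP: "g \<in> borel_measurable P" using g by (rule measurable_F_imp_P)
  show ig: "integrable P (\<lambda>\<omega>. g \<omega> * Z t \<omega>)"
  proof (rule Bochner_Integration.integrable_bound)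
    show "integrable P (\<lambda>\<omega>. C * Z t \<omega>)" using int by simp
    show "AE \<omega> in P. norm (g \<omega> * Z t \<omega>) \<le> norm (C * Z t \<omega>)"
    proof (rule AE_I2)
      fix \<omega> assume "\<omega> \<in> space P"
      then have "\<bar>g \<omega>\<bar> \<le> \<bar>C\<bar>" using C[of \<omega>] by linarith
      then show "norm (g \<omega> * Z t \<omega>) \<le> norm (C * Z t \<omega>)"
        by (simp add: abs_mult mult_right_mono)
    qed
  qed (use gP int in measurable)
  interpret sub: finite_measure_subalgebra P "F s"
    by unfold_locales (rule subalgebra_F)
  have "(\<integral>\<omega>. g \<omega> * Z t \<omega> \<partial>P) = (\<integral>\<omega>. g \<omega> * real_cond_exp P (F s) (Z t) \<omega> \<partial>P)"
    using sub.real_cond_exp_intg(2)[OF ig g] int by simp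
  also have "\<dots> = (\<integral>\<omega>. g \<omega> * Z s \<omega> \<partial>P)"
  proof (rule integral_cong_AE)
    show "(\<lambda>\<omega>. g \<omega> * Z s \<omega>) \<in> borel_measurable P"
      using Z st gP by (intro borel_measurable_times measurable_F_imp_P[of "Z s" s])
        (auto simp: martingale_def adapted_def)
    show "(\<lambda>\<omega>. g \<omega> * real_cond_exp P (F s) (Z t) \<omega>) \<in> borel_measurable P"
      using gP by simp
  qed (use cond in auto)
  finally show "(\<integral>\<omega>. g \<omega> * Z s \<omega> \<partial>P) = (\<integral>\<omega>. g \<omega> * Z t \<omega> \<partial>P)" by simp
qed

text \<open>Split by the finitely many values of the grid time. On each piece the weight, including
  the factor \<phi> applied to the stopped value itself, is known at that grid time, so
  \<open>martingale_integral_eq\<close> applies. The factor \<phi> later serves both as the constant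
  1 and as the indicator of large values.\<close>

lemma optional_stopping_grid:
  fixes n :: nat
  assumes Z: "martingale P F Z" and T: "stopping_time F T"
    and TK: "\<And>\<omega>. \<omega> \<in> space P \<Longrightarrow> 0 \<le> T \<omega> \<and> T \<omega> \<le> K" and U: "K + 1 \<le> U"
    and g: "g \<in> borel_measurable (pre_sigma T)" and C: "\<And>\<omega>. \<omega> \<in> space P \<Longrightarrow> \<bar>g \<omega>\<bar> \<le> C"
    and \<phi>: "\<phi> \<in> borel_measurable borel" "\<And>x. \<bar>\<phi> x\<bar> \<le> (1::real)"
  defines "G \<equiv> (\<lambda>\<omega>. grid_above n (T \<omega>))"
  shows "integrable P (\<lambda>\<omega>. g \<omega> * \<phi> (Z (G \<omega>) \<omega>) * Z (G \<omega>) \<omega>)"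
    and "integrable P (\<lambda>\<omega>. g \<omega> * \<phi> (Z (G \<omega>) \<omega>) * Z U \<omega>)"
    and "(\<integral>\<omega>. g \<omega> * \<phi> (Z (G \<omega>) \<omega>) * Z (G \<omega>) \<omega> \<partial>P) = (\<integral>\<omega>. g \<omega> * \<phi> (Z (G \<omega>) \<omega>) * Z U \<omega> \<partial>P)"
proof -
  define N where "N = real (Suc n)"
  have N: "0 < N" "1 \<le> N" by (auto simp: N_def)
  define I where "I = {0..\<lfloor>N * K\<rfloor>}"
  define h where "h = (\<lambda>i \<omega>. (if \<lfloor>N * T \<omega>\<rfloor> = i then g \<omega> else 0) * \<phi> (Z ((of_int i + 1) / N) \<omega>))"
  have I: "finite I" "\<And>\<omega>. \<omega> \<in> space P \<Longrightarrow> \<lfloor>N * T \<omega>\<rfloor> \<in> I"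
    using TK N by (auto simp: I_def intro!: floor_mono mult_left_mono)
  have h_sum: "(\<Sum>i\<in>I. h i \<omega> * V ((of_int i + 1) / N)) = g \<omega> * \<phi> (Z (G \<omega>) \<omega>) * V (G \<omega>)"
    if "\<omega> \<in> space P" for \<omega> and V :: "real \<Rightarrow> real"
  proof -
    have "(\<Sum>i\<in>I. h i \<omega> * V ((of_int i + 1) / N))
        = (\<Sum>i\<in>I. if \<lfloor>N * T \<omega>\<rfloor> = i then g \<omega> * \<phi> (Z (G \<omega>) \<omega>) * V (G \<omega>) else 0)"
      by (intro sum.cong) (auto simp: h_def G_def grid_above_def N_def)
    then show ?thesis using I that by (simp add: sum.delta)
  qed
  have h_sum_Z: "(\<Sum>i\<in>I. h i \<omega> * Z ((of_int i + 1) / N) \<omega>) = g \<omega> * \<phi> (Z (G \<omega>) \<omega>) * Z (G \<omega>) \<omega>"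
    and h_sum_U: "(\<Sum>i\<in>I. h i \<omega> * Z U \<omega>) = g \<omega> * \<phi> (Z (G \<omega>) \<omega>) * Z U \<omega>"
    if "\<omega> \<in> space P" for \<omega>
    using h_sum[OF that, of "\<lambda>t. Z t \<omega>"] h_sum[OF that, of "\<lambda>_. Z U \<omega>"] by simp_all
  \<comment> \<open>A grid time exceeds K by at most 1 / N \<le> 1. Hence the unit of room below
    \<open>U\<close>, which makes one terminal time serve every n.\<close>
  have ti: "0 \<le> (of_int i + 1) / N" "(of_int i + 1) / N \<le> U" if "i \<in> I" for i
  proof -
    show "0 \<le> (of_int i + 1) / N" using that N by (auto simp: I_def)
    have "of_int i \<le> N * K" using that by (simp add: I_def le_floor_iff)
    then have "of_int i + 1 \<le> (K + 1) * N" using N by (simp add: algebra_simps)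
    also have "\<dots> \<le> U * N" using U N by (intro mult_right_mono) auto
    finally show "(of_int i + 1) / N \<le> U" using N by (simp add: pos_divide_le_eq)
  qed
  have hm: "h i \<in> borel_measurable (F ((of_int i + 1) / N))" if i: "i \<in> I" for i
  proof -
    let ?t = "(of_int i + 1) / N"
    have a: "(\<lambda>\<omega>. if T \<omega> \<le> ?t then g \<omega> else 0) \<in> borel_measurable (F ?t)"
      by (rule pre_sigma_restrict_measurable[OF T g])
    have b: "Measurable.pred (F ?t) (\<lambda>\<omega>. T \<omega> < of_int i / N)"
      using N by (intro measurable_F_mono[OF stopping_time_less_const[OF T]]) (auto intro!: divide_right_mono)
    have c: "Measurable.pred (F ?t) (\<lambda>\<omega>. T \<omega> < ?t)" by (rule stopping_time_less_const[OF T])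
    have d: "Z ?t \<in> borel_measurable (F ?t)"
      using Z ti[OF i] by (auto simp: martingale_def adapted_def)
    \<comment> \<open>The outer test is the floor event. The inner test T \<le> t holds there
      automatically, but it is what makes the factor \<open>g\<close> measurable at the grid
      time.\<close>
    have "(\<lambda>\<omega>. (if \<not> T \<omega> < of_int i / N \<and> T \<omega> < ?t then (if T \<omega> \<le> ?t then g \<omega> else 0) else 0) * \<phi> (Z ?t \<omega>))
      \<in> borel_measurable (F ?t)"
      using a b c measurable_compose[OF d \<phi>(1)] by measurable
    also have "(\<lambda>\<omega>. (if \<not> T \<omega> < of_int i / N \<and> T \<omega> < ?t then (if T \<omega> \<le> ?t then g \<omega> else 0) else 0) * \<phi> (Z ?t \<omega>)) = h i"
      using N by (auto simp: h_def fun_eq_iff floor_eq_iff pos_divide_le_eq pos_less_divide_eq pos_le_divide_eq not_less mult.commute)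
    finally show ?thesis .
  qed
  have hC: "\<bar>h i \<omega>\<bar> \<le> C" if "\<omega> \<in> space P" for i \<omega>
    using C[OF that] \<phi>(2)[of "Z ((of_int i + 1) / N) \<omega>"]
      mult_mono[OF C[OF that] \<phi>(2)[of "Z ((of_int i + 1) / N) \<omega>"]]
    by (auto simp: h_def abs_mult)
  have i1: "integrable P (\<lambda>\<omega>. h i \<omega> * Z ((of_int i + 1) / N) \<omega>)" if "i \<in> I" for i
    using martingale_integral_eq(1)[OF Z ti(1)[OF that] order_refl hm[OF that] hC] .
  have i2: "integrable P (\<lambda>\<omega>. h i \<omega> * Z U \<omega>)" if "i \<in> I" for i
    using martingale_integral_eq(1)[OF Z ti[OF that] hm[OF that] hC] .
  have "integrable P (\<lambda>\<omega>. \<Sum>i\<in>I. h i \<omega> * Z ((of_int i + 1) / N) \<omega>)" using i1 by simp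
  then show "integrable P (\<lambda>\<omega>. g \<omega> * \<phi> (Z (G \<omega>) \<omega>) * Z (G \<omega>) \<omega>)"
    by (rule Bochner_Integration.integrable_cong[THEN iffD1, rotated 2]) (simp_all add: h_sum_Z)
  have "integrable P (\<lambda>\<omega>. \<Sum>i\<in>I. h i \<omega> * Z U \<omega>)" using i2 by simp
  then show "integrable P (\<lambda>\<omega>. g \<omega> * \<phi> (Z (G \<omega>) \<omega>) * Z U \<omega>)"
    by (rule Bochner_Integration.integrable_cong[THEN iffD1, rotated 2])
       (simp_all add: h_sum_U)
  have "(\<integral>\<omega>. g \<omega> * \<phi> (Z (G \<omega>) \<omega>) * Z (G \<omega>) \<omega> \<partial>P) = (\<integral>\<omega>. (\<Sum>i\<in>I. h i \<omega> * Z ((of_int i + 1) / N) \<omega>) \<partial>P)"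
    by (rule Bochner_Integration.integral_cong) (simp_all add: h_sum_Z)
  also have "\<dots> = (\<Sum>i\<in>I. \<integral>\<omega>. h i \<omega> * Z ((of_int i + 1) / N) \<omega> \<partial>P)"
    using i1 by simp
  also have "\<dots> = (\<Sum>i\<in>I. \<integral>\<omega>. h i \<omega> * Z U \<omega> \<partial>P)"
    using martingale_integral_eq(2)[OF Z ti hm hC] by simp
  also have "\<dots> = (\<integral>\<omega>. (\<Sum>i\<in>I. h i \<omega> * Z U \<omega>) \<partial>P)"
    using i2 by simp
  also have "\<dots> = (\<integral>\<omega>. g \<omega> * \<phi> (Z (G \<omega>) \<omega>) * Z U \<omega> \<partial>P)"
    by (rule Bochner_Integration.integral_cong) (simp_all add: h_sum_U)
  finally show "(\<integral>\<omega>. g \<omega> * \<phi> (Z (G \<omega>) \<omega>) * Z (G \<omega>) \<omega> \<partial>P) = (\<integral>\<omega>. g \<omega> * \<phi> (Z (G \<omega>) \<omega>) * Z U \<omega> \<partial>P)" .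
qed

text \<open>
  Approximate \<open>T\<close> from above by grid times \<open>T\<^sub>n\<close>. Uniform integrability is not needed: on
  \<open>{\<bar>Z T\<^sub>n\<bar> > L + 1}\<close> the value \<open>Z T\<^sub>n\<close> is replaced by the fixed integrable \<open>Z U\<close>, and the indicator
  of this event tends to \<open>0\<close>.
\<close>

lemma optional_stopping_bounded:
  assumes Z: "martingale P F Z" and cont: "cont_adapted Z" and T: "stopping_time F T"
    and TK: "\<And>\<omega>. \<omega> \<in> space P \<Longrightarrow> 0 \<le> T \<omega> \<and> T \<omega> \<le> K" and U: "K + 1 \<le> U"
    and g: "g \<in> borel_measurable (pre_sigma T)" and C: "\<And>\<omega>. \<omega> \<in> space P \<Longrightarrow> \<bar>g \<omega>\<bar> \<le> C"
    and L: "\<And>\<omega>. \<omega> \<in> space P \<Longrightarrow> g \<omega> \<noteq> 0 \<Longrightarrow> \<bar>Z (T \<omega>) \<omega>\<bar> \<le> L"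
  shows "(\<integral>\<omega>. g \<omega> * Z (T \<omega>) \<omega> \<partial>P) = (\<integral>\<omega>. g \<omega> * Z U \<omega> \<partial>P)"
proof -
  define W where "W = (\<lambda>n \<omega>. Z (grid_above n (T \<omega>)) \<omega>)"
  \<comment> \<open>The threshold is L + 1, not L, so that the limit, bounded by L, lies strictly
    inside: along the approximating times \<phi> eventually vanishes wherever g is nonzero.\<close>
  define \<phi> where "\<phi> = (\<lambda>x::real. if L + 1 < \<bar>x\<bar> then 1 else 0 :: real)"
  have \<phi>: "\<phi> \<in> borel_measurable borel" "\<And>x. \<bar>\<phi> x\<bar> \<le> 1" by (auto simp: \<phi>_def)
  have A: "integrable P (\<lambda>\<omega>. g \<omega> * \<phi> (W n \<omega>) * W n \<omega>)" "integrable P (\<lambda>\<omega>. g \<omega> * \<phi> (W n \<omega>) * Z U \<omega>)"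
    "(\<integral>\<omega>. g \<omega> * \<phi> (W n \<omega>) * W n \<omega> \<partial>P) = (\<integral>\<omega>. g \<omega> * \<phi> (W n \<omega>) * Z U \<omega> \<partial>P)" for n
    using optional_stopping_grid[OF Z T TK U g C \<phi>] unfolding W_def by simp_all
  have B: "integrable P (\<lambda>\<omega>. g \<omega> * W n \<omega>)" "integrable P (\<lambda>\<omega>. g \<omega> * Z U \<omega>)"
    "(\<integral>\<omega>. g \<omega> * W n \<omega> \<partial>P) = (\<integral>\<omega>. g \<omega> * Z U \<omega> \<partial>P)" for n
    using optional_stopping_grid[OF Z T TK U g C, of "\<lambda>_. 1" n] unfolding W_def by simp_all
  have T0: "\<And>\<omega>. \<omega> \<in> space P \<Longrightarrow> 0 \<le> T \<omega>" using TK by blast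
  have W_lim: "(\<lambda>n. W n \<omega>) \<longlonglongrightarrow> Z (T \<omega>) \<omega>" if "\<omega> \<in> space P" for \<omega>
  proof -
    have "(\<lambda>n. grid_above n (T \<omega>)) \<longlonglongrightarrow> T \<omega>"
      by (rule grid_above_tendsto)
    moreover have "0 \<le> grid_above n (T \<omega>)" for n
      using less_grid_above[of "T \<omega>" n] T0[OF that] by linarith
    ultimately show ?thesis unfolding W_def
      using T0[OF that]
      by (intro continuous_on_tendsto_compose[OF cont_adaptedD(2)[OF cont that]]) (auto intro: always_eventually)
  qed
  have small: "\<forall>\<^sub>F n in sequentially. g \<omega> = 0 \<or> \<phi> (W n \<omega>) = 0" if \<omega>: "\<omega> \<in> space P" for \<omega>
  proof (cases "g \<omega> = 0")
    case False
    then have "\<bar>Z (T \<omega>) \<omega>\<bar> < L + 1" using L[OF \<omega>] by fastforce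
    then have "\<forall>\<^sub>F n in sequentially. \<bar>W n \<omega>\<bar> < L + 1"
      using tendsto_rabs[OF W_lim[OF \<omega>]] by (auto intro: order_tendstoD)
    then show ?thesis by eventually_elim (auto simp: \<phi>_def)
  qed simp
  have gP: "g \<in> borel_measurable P" by (rule pre_sigma_imp_P[OF T g])
  have ZTP: "(\<lambda>\<omega>. Z (T \<omega>) \<omega>) \<in> borel_measurable P"
    by (rule pre_sigma_imp_P[OF T cont_adapted_at_stopping_time[OF cont T T0]])
  have lim1: "(\<lambda>n. \<integral>\<omega>. g \<omega> * \<phi> (W n \<omega>) * Z U \<omega> \<partial>P) \<longlonglongrightarrow> (\<integral>\<omega>. 0 \<partial>P)"
  proof (rule integral_dominated_convergence)
    show "integrable P (\<lambda>\<omega>. \<bar>g \<omega> * Z U \<omega>\<bar>)" using B(2) by (rule integrable_abs)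
    show "AE \<omega> in P. (\<lambda>n. g \<omega> * \<phi> (W n \<omega>) * Z U \<omega>) \<longlonglongrightarrow> 0"
      using small by (intro AE_I2 tendsto_eventually) (fastforce elim: eventually_mono)
    show "AE \<omega> in P. norm (g \<omega> * \<phi> (W n \<omega>) * Z U \<omega>) \<le> \<bar>g \<omega> * Z U \<omega>\<bar>" for n
      by (auto simp: \<phi>_def)
  qed (use A(2) in \<open>auto dest: borel_measurable_integrable\<close>)
  have lim2: "(\<lambda>n. \<integral>\<omega>. g \<omega> * W n \<omega> - g \<omega> * \<phi> (W n \<omega>) * W n \<omega> \<partial>P) \<longlonglongrightarrow> (\<integral>\<omega>. g \<omega> * Z (T \<omega>) \<omega> \<partial>P)"
  proof (rule integral_dominated_convergence)
    show "(\<lambda>\<omega>. g \<omega> * Z (T \<omega>) \<omega>) \<in> borel_measurable P" using gP ZTP by measurable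
    show "(\<lambda>\<omega>. g \<omega> * W n \<omega> - g \<omega> * \<phi> (W n \<omega>) * W n \<omega>) \<in> borel_measurable P" for n
      using B(1) A(1) by (intro borel_measurable_diff) (auto dest: borel_measurable_integrable)
    show "integrable P (\<lambda>\<omega>. C * (\<bar>L\<bar> + 1))" by simp
    show "AE \<omega> in P. (\<lambda>n. g \<omega> * W n \<omega> - g \<omega> * \<phi> (W n \<omega>) * W n \<omega>) \<longlonglongrightarrow> g \<omega> * Z (T \<omega>) \<omega>"
    proof (rule AE_I2)
      fix \<omega> assume \<omega>: "\<omega> \<in> space P"
      have "(\<lambda>n. g \<omega> * W n \<omega>) \<longlonglongrightarrow> g \<omega> * Z (T \<omega>) \<omega>" by (intro tendsto_intros W_lim \<omega>)
      moreover have "\<forall>\<^sub>F n in sequentially. g \<omega> * W n \<omega> = g \<omega> * W n \<omega> - g \<omega> * \<phi> (W n \<omega>) * W n \<omega>"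
        using small[OF \<omega>] by eventually_elim auto
      ultimately show "(\<lambda>n. g \<omega> * W n \<omega> - g \<omega> * \<phi> (W n \<omega>) * W n \<omega>) \<longlonglongrightarrow> g \<omega> * Z (T \<omega>) \<omega>"
        by (rule Lim_transform_eventually)
    qed
    show "AE \<omega> in P. norm (g \<omega> * W n \<omega> - g \<omega> * \<phi> (W n \<omega>) * W n \<omega>) \<le> C * (\<bar>L\<bar> + 1)" for n
    proof (rule AE_I2)
      fix \<omega> assume "\<omega> \<in> space P"
      then have c: "\<bar>g \<omega>\<bar> \<le> C" by (rule C)
      show "norm (g \<omega> * W n \<omega> - g \<omega> * \<phi> (W n \<omega>) * W n \<omega>) \<le> C * (\<bar>L\<bar> + 1)"
      proof (cases "L + 1 < \<bar>W n \<omega>\<bar>")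
        case False
        then have "\<bar>g \<omega>\<bar> * \<bar>W n \<omega>\<bar> \<le> C * (\<bar>L\<bar> + 1)" using c by (intro mult_mono) auto
        with False show ?thesis by (simp add: \<phi>_def abs_mult)
      qed (use c in \<open>auto simp: \<phi>_def\<close>)
    qed
  qed
  have "(\<integral>\<omega>. g \<omega> * W n \<omega> - g \<omega> * \<phi> (W n \<omega>) * W n \<omega> \<partial>P)
      = (\<integral>\<omega>. g \<omega> * Z U \<omega> \<partial>P) - (\<integral>\<omega>. g \<omega> * \<phi> (W n \<omega>) * Z U \<omega> \<partial>P)" for n
    using A(1)[of n] A(3)[of n] B(1)[of n] B(3)[of n] by simp
  with lim2 have "(\<lambda>n. (\<integral>\<omega>. g \<omega> * Z U \<omega> \<partial>P) - (\<integral>\<omega>. g \<omega> * \<phi> (W n \<omega>) * Z U \<omega> \<partial>P)) \<longlonglongrightarrow> (\<integral>\<omega>. g \<omega> * Z (T \<omega>) \<omega> \<partial>P)"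
    by simp
  moreover have "(\<lambda>n. (\<integral>\<omega>. g \<omega> * Z U \<omega> \<partial>P) - (\<integral>\<omega>. g \<omega> * \<phi> (W n \<omega>) * Z U \<omega> \<partial>P)) \<longlonglongrightarrow> (\<integral>\<omega>. g \<omega> * Z U \<omega> \<partial>P) - 0"
    using lim1 by (intro tendsto_intros) simp
  ultimately show ?thesis using LIMSEQ_unique by fastforce
qed

end

section \<open>Exceeding the square root of the clock\<close>

text \<open>
  \<open>x\<close> and \<open>y\<close> are the rescaled increments of \<open>N\<close> and \<open>a\<close> over one step, and \<open>G\<close> is the event that the
  step was cut off. The left-hand side has expectation \<open>2 / 25\<close>, as \<open>x\<close> and \<open>x\<^sup>2 - y\<close> are centred.
\<close>

lemma step_inequality:
  fixes x y :: real
  assumes "\<bar>x\<bar> \<le> 2" "0 \<le> y" "y \<le> 1" "\<bar>x\<bar> = 2 \<or> y = 1 \<or> G"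
  shows "2 / 25 + 6 / 25 * x + (x\<^sup>2 - y) / 10 \<le> of_bool (1 / 16 < x) + of_bool G"
proof -
  have four: "x\<^sup>2 \<le> 4" using assms(1) abs_le_square_iff[of x 2] by simp
  \<comment> \<open>The coefficients make the left-hand side exactly 0 at x = -2, y = 0, and 24 / 25
    at x = 2, y = 0. For y = 1 it is a quadratic in x whose positive root (sqrt 41 - 6) / 5, about
    0.08, lies above 1 / 16.\<close>
  consider "1 / 16 < x" | "x \<le> 1 / 16" "x = -2" | "x \<le> 1 / 16" "y = 1" | "x \<le> 1 / 16" G
    using assms(1,4) by fastforce
  then show ?thesis
  proof cases
    case 1
    have "x \<le> 2" using assms(1) by simp
    then have "2 / 25 + 6 / 25 * x + (x\<^sup>2 - y) / 10 \<le> 1"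
      using four assms(2) by (simp add: field_simps)
    then show ?thesis using 1 by simp
  next
    case 2
    then show ?thesis using assms(2) by (simp add: field_simps)
  next
    case 3
    \<comment> \<open>On [-2, 1 / 16] the square lies below its chord; this leaves a linear function
      of x, which is negative at 1 / 16 and increasing.\<close>
    have "0 \<le> (x + 2) * (1 / 16 - x)" using assms(1) 3 by (intro mult_nonneg_nonneg) auto
    then have "x\<^sup>2 \<le> 1 / 8 - 31 / 16 * x" by (simp add: algebra_simps power2_eq_square)
    then have "2 / 25 + 6 / 25 * x + (x\<^sup>2 - y) / 10 \<le> 0"
      using 3 by (simp add: field_simps)
    then show ?thesis by (rule order_trans) simp
  next
    case 4
    then have "2 / 25 + 6 / 25 * x + (x\<^sup>2 - y) / 10 \<le> 1"
      using four assms(2) by (simp add: field_simps)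
    then show ?thesis using 4 by (simp add: of_bool_def)
  qed
qed

text \<open>Isolates what the probabilistic argument uses, with no trace of coordinates or
  localization. \<open>increments\<close> is the conditional centring of N and of its compensated
  square given the past of \<open>S\<close>, stated through integrals over events inside
  \<open>B\<^sub>0\<close>. In the application \<open>B\<^sub>0\<close> is the event on which N has
  not yet exceeded c sqrt a up to \<rho>, although \<sigma> < \<rho>.\<close>

locale martingale_with_clock = usual_filtered_prob_space P F
  for P :: "'a measure" and F :: "real \<Rightarrow> 'a measure" +
  fixes \<sigma> \<rho> :: "'a \<Rightarrow> real" and K :: real and N a :: "real \<Rightarrow> 'a \<Rightarrow> real" and B\<^sub>0 :: "'a set"
  assumes \<sigma>: "stopping_time F \<sigma>" and \<rho>: "stopping_time F \<rho>"
    and bounds: "\<And>\<omega>. \<omega> \<in> space P \<Longrightarrow> 0 \<le> \<sigma> \<omega> \<and> \<sigma> \<omega> \<le> \<rho> \<omega> \<and> \<rho> \<omega> \<le> K"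
    and N: "cont_adapted N" and a: "cont_adapted a"
    and start: "\<And>\<omega>. \<omega> \<in> space P \<Longrightarrow> N (\<sigma> \<omega>) \<omega> = 0 \<and> a (\<sigma> \<omega>) \<omega> = 0"
    and B\<^sub>0: "B\<^sub>0 \<in> sets (pre_sigma \<sigma>)"
    and clock_mono: "\<And>\<omega> s t. \<omega> \<in> B\<^sub>0 \<Longrightarrow> \<sigma> \<omega> \<le> s \<Longrightarrow> s \<le> t \<Longrightarrow> t \<le> \<rho> \<omega> \<Longrightarrow> a s \<omega> \<le> a t \<omega>"
    and increments: "\<And>S T B. stopping_time F S \<Longrightarrow> stopping_time F T \<Longrightarrow>
      (\<And>\<omega>. \<omega> \<in> space P \<Longrightarrow> \<sigma> \<omega> \<le> S \<omega> \<and> S \<omega> \<le> T \<omega> \<and> T \<omega> \<le> \<rho> \<omega>) \<Longrightarrow>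
      B \<in> sets (pre_sigma S) \<Longrightarrow> B \<subseteq> B\<^sub>0 \<Longrightarrow>
      (\<integral>\<omega>. indicator B \<omega> * (N (T \<omega>) \<omega> - N (S \<omega>) \<omega>) \<partial>P) = 0 \<and>
      (\<integral>\<omega>. indicator B \<omega> * ((N (T \<omega>) \<omega> - N (S \<omega>) \<omega>)\<^sup>2 - (a (T \<omega>) \<omega> - a (S \<omega>) \<omega>)) \<partial>P) = 0"
begin

lemma at_stopping_time_P:
  assumes "cont_adapted Z" "stopping_time F T" "\<And>\<omega>. \<omega> \<in> space P \<Longrightarrow> 0 \<le> T \<omega>"
  shows "(\<lambda>\<omega>. Z (T \<omega>) \<omega>) \<in> borel_measurable P"
  by (rule pre_sigma_imp_P[OF assms(2) cont_adapted_at_stopping_time[OF assms]])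

text \<open>Integrate \<open>step_inequality\<close> over \<open>B\<close>, with the increment of N
  divided by sqrt r and that of a divided by r. The two centred terms drop out and the constant 2 /
  25 remains.\<close>

lemma one_step:
  assumes S: "stopping_time F S" and S\<rho>: "\<And>\<omega>. \<omega> \<in> space P \<Longrightarrow> \<sigma> \<omega> \<le> S \<omega> \<and> S \<omega> \<le> \<rho> \<omega>"
    and B: "B \<in> sets (pre_sigma S)" "B \<subseteq> B\<^sub>0" and r: "0 < r"
  obtains T where "stopping_time F T" "\<And>\<omega>. \<omega> \<in> space P \<Longrightarrow> S \<omega> \<le> T \<omega> \<and> T \<omega> \<le> \<rho> \<omega>"
    "\<And>\<omega>. \<omega> \<in> space P \<Longrightarrow> a (T \<omega>) \<omega> \<le> a (S \<omega>) \<omega> + r"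
    "2 / 25 * prob B \<le> prob {\<omega> \<in> B. sqrt r / 16 < N (T \<omega>) \<omega> - N (S \<omega>) \<omega>}
      + prob {\<omega> \<in> B. a (\<rho> \<omega>) \<omega> < a (S \<omega>) \<omega> + r}"
proof
  have S0: "0 \<le> S \<omega>" and \<rho>0: "0 \<le> \<rho> \<omega>" if "\<omega> \<in> space P" for \<omega>
    using S\<rho>[OF that] bounds[OF that] by auto
  have BP: "B \<in> sets P" and Bsub: "B \<subseteq> space P"
    using B(1) subalgebra_pre_sigma[OF S] sets.sets_into_space[OF B(1)]
    by (auto simp: subalgebra_def space_pre_sigma)
  \<comment> \<open>Subtracting the value at the minimum of t and S makes both processes vanish up
    to S, so neither level is hit before S.\<close>
  define f where "f = (\<lambda>t \<omega>. \<bar>N t \<omega> - N (min t (S \<omega>)) \<omega>\<bar>)"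
  define h where "h = (\<lambda>t \<omega>. a t \<omega> - a (min t (S \<omega>)) \<omega>)"
  \<comment> \<open>A nonnegative horizon that is at least K: whenever T < \<rho>, the hitting time
    that stopped T is then below the horizon and hence not the default value.\<close>
  define K' where "K' = max 0 K"
  have K': "0 \<le> K'" "K \<le> K'" by (auto simp: K'_def)
  define T\<^sub>1 where "T\<^sub>1 = hit f (2 * sqrt r) K'"
  define T\<^sub>2 where "T\<^sub>2 = hit h r K'"
  define T where "T = (\<lambda>\<omega>. min (\<rho> \<omega>) (min (T\<^sub>1 \<omega>) (T\<^sub>2 \<omega>)))"
  have f_ad: "adapted F f" and h_ad: "adapted F h"
    using cont_adapted_stopped[OF N S S0] cont_adapted_stopped[OF a S S0] N a
    by (auto simp: cont_adapted_def adapted_def f_def h_def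
        intro!: borel_measurable_abs borel_measurable_diff)
  have f_c: "continuous_on {0..} (\<lambda>t. f t \<omega>)" and h_c: "continuous_on {0..} (\<lambda>t. h t \<omega>)" if "\<omega> \<in> space P" for \<omega>
    using that cont_adapted_stopped[OF N S S0] cont_adapted_stopped[OF a S S0] N a
    by (auto simp: cont_adapted_def f_def h_def intro!: continuous_intros)
  show T: "stopping_time F T"
    unfolding T_def T\<^sub>1_def T\<^sub>2_def
    by (intro stopping_time_min \<rho> stopping_time_hit f_ad h_ad K')
  have ge: "S \<omega> \<le> T\<^sub>1 \<omega>" "S \<omega> \<le> T\<^sub>2 \<omega>" if "\<omega> \<in> space P" for \<omega>
  proof -
    have "S \<omega> \<le> K'" using S\<rho>[OF that] bounds[OF that] K' by linarith
    then show "S \<omega> \<le> T\<^sub>1 \<omega>" "S \<omega> \<le> T\<^sub>2 \<omega>"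
      using r hit_less_iff[OF K'(1), of f "2 * sqrt r" \<omega> "S \<omega>"] hit_less_iff[OF K'(1), of h r \<omega> "S \<omega>"]
      by (fastforce simp: T\<^sub>1_def T\<^sub>2_def f_def h_def not_less[symmetric])+
  qed
  show ST: "S \<omega> \<le> T \<omega> \<and> T \<omega> \<le> \<rho> \<omega>" if "\<omega> \<in> space P" for \<omega>
    using ge[OF that] S\<rho>[OF that] by (auto simp: T_def)
  have f0: "f 0 \<omega> = 0" "h 0 \<omega> = 0" if "\<omega> \<in> space P" for \<omega>
    using S0[OF that] by (auto simp: f_def h_def)
  have upper: "f (T \<omega>) \<omega> \<le> 2 * sqrt r" "h (T \<omega>) \<omega> \<le> r" if "\<omega> \<in> space P" for \<omega>
  proof -
    have T0: "0 \<le> T \<omega>" using ST[OF that] S0[OF that] by linarith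
    show "f (T \<omega>) \<omega> \<le> 2 * sqrt r"
    proof (cases "T \<omega> = T\<^sub>1 \<omega>")
      case True
      then show ?thesis using not_above_at_hit[where f=f, OF f_c[OF that] K'(1)] f0[OF that] r
        by (simp add: T\<^sub>1_def)
    next
      case False
      then have "T \<omega> < T\<^sub>1 \<omega>" by (auto simp: T_def)
      then show ?thesis using not_above_before_hit[where f=f, OF f_c[OF that] K'(1) T0] by (simp add: T\<^sub>1_def)
    qed
    show "h (T \<omega>) \<omega> \<le> r"
    proof (cases "T \<omega> = T\<^sub>2 \<omega>")
      case True
      then show ?thesis using not_above_at_hit[where f=h, OF h_c[OF that] K'(1)] f0[OF that] r
        by (simp add: T\<^sub>2_def)
    next
      case False
      then have "T \<omega> < T\<^sub>2 \<omega>" by (auto simp: T_def)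
      then show ?thesis using not_above_before_hit[where f=h, OF h_c[OF that] K'(1) T0] by (simp add: T\<^sub>2_def)
    qed
  qed
  have fT: "f (T \<omega>) \<omega> = \<bar>N (T \<omega>) \<omega> - N (S \<omega>) \<omega>\<bar>" "h (T \<omega>) \<omega> = a (T \<omega>) \<omega> - a (S \<omega>) \<omega>" if "\<omega> \<in> space P" for \<omega>
    using ST[OF that] by (auto simp: f_def h_def min_def)
  show aT: "a (T \<omega>) \<omega> \<le> a (S \<omega>) \<omega> + r" if "\<omega> \<in> space P" for \<omega>
    using upper(2)[OF that] fT(2)[OF that] by linarith
  have stop: "T \<omega> = \<rho> \<omega> \<or> f (T \<omega>) \<omega> = 2 * sqrt r \<or> h (T \<omega>) \<omega> = r" if "\<omega> \<in> space P" for \<omega>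
  proof (cases "T \<omega> = \<rho> \<omega>")
    case False
    then have lt: "T \<omega> < K'" and or: "T \<omega> = T\<^sub>1 \<omega> \<or> T \<omega> = T\<^sub>2 \<omega>"
      using bounds[OF that] K' by (auto simp: T_def min_def split: if_splits)
    from or show ?thesis
    proof
      assume "T \<omega> = T\<^sub>1 \<omega>"
      then have "2 * sqrt r \<le> f (T \<omega>) \<omega>"
        using not_below_at_hit[where f=f, OF f_c[OF that] K'(1)] lt by (simp add: T\<^sub>1_def)
      then show ?thesis using upper(1)[OF that] by auto
    next
      assume "T \<omega> = T\<^sub>2 \<omega>"
      then have "r \<le> h (T \<omega>) \<omega>"
        using not_below_at_hit[where f=h, OF h_c[OF that] K'(1)] lt by (simp add: T\<^sub>2_def)
      then show ?thesis using upper(2)[OF that] by auto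
    qed
  qed simp
  define x where "x = (\<lambda>\<omega>. N (T \<omega>) \<omega> - N (S \<omega>) \<omega>)"
  define y where "y = (\<lambda>\<omega>. a (T \<omega>) \<omega> - a (S \<omega>) \<omega>)"
  let ?A = "{\<omega> \<in> B. sqrt r / 16 < N (T \<omega>) \<omega> - N (S \<omega>) \<omega>}"
  let ?G = "{\<omega> \<in> B. a (\<rho> \<omega>) \<omega> < a (S \<omega>) \<omega> + r}"
  have T0: "0 \<le> T \<omega>" if "\<omega> \<in> space P" for \<omega> using ST[OF that] S0[OF that] by linarith
  have meas[measurable]: "(\<lambda>\<omega>. N (T \<omega>) \<omega>) \<in> borel_measurable P" "(\<lambda>\<omega>. N (S \<omega>) \<omega>) \<in> borel_measurable P"
    "(\<lambda>\<omega>. a (T \<omega>) \<omega>) \<in> borel_measurable P" "(\<lambda>\<omega>. a (S \<omega>) \<omega>) \<in> borel_measurable P"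
    "(\<lambda>\<omega>. a (\<rho> \<omega>) \<omega>) \<in> borel_measurable P" "B \<in> sets P"
    using BP at_stopping_time_P[OF N T T0] at_stopping_time_P[OF N S S0] at_stopping_time_P[OF a T T0]
      at_stopping_time_P[OF a S S0] at_stopping_time_P[OF a \<rho> \<rho>0] by auto
  have AP: "?A \<in> sets P" "?G \<in> sets P"
  proof -
    have "?A = B \<inter> {\<omega> \<in> space P. sqrt r / 16 < N (T \<omega>) \<omega> - N (S \<omega>) \<omega>}"
      "?G = B \<inter> {\<omega> \<in> space P. a (\<rho> \<omega>) \<omega> < a (S \<omega>) \<omega> + r}" using Bsub by auto
    moreover have "B \<inter> {\<omega> \<in> space P. sqrt r / 16 < N (T \<omega>) \<omega> - N (S \<omega>) \<omega>} \<in> sets P"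
      "B \<inter> {\<omega> \<in> space P. a (\<rho> \<omega>) \<omega> < a (S \<omega>) \<omega> + r} \<in> sets P" by measurable
    ultimately show "?A \<in> sets P" "?G \<in> sets P" by simp_all
  qed
  have xb: "\<bar>x \<omega>\<bar> \<le> 2 * sqrt r" and yb: "0 \<le> y \<omega>" "y \<omega> \<le> r" if "\<omega> \<in> B" for \<omega>
  proof -
    have \<omega>: "\<omega> \<in> space P" using that Bsub by blast
    show "\<bar>x \<omega>\<bar> \<le> 2 * sqrt r" "y \<omega> \<le> r" using upper[OF \<omega>] fT[OF \<omega>] by (auto simp: x_def y_def)
    have "a (S \<omega>) \<omega> \<le> a (T \<omega>) \<omega>" using ST[OF \<omega>] S\<rho>[OF \<omega>] that B(2) by (intro clock_mono) auto
    then show "0 \<le> y \<omega>" by (simp add: y_def)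
  qed
  have ix: "integrable P (\<lambda>\<omega>. indicator B \<omega> * x \<omega>)"
  proof (rule integrable_const_bound[where B="2 * sqrt r"])
    show "AE \<omega> in P. norm (indicator B \<omega> * x \<omega>) \<le> 2 * sqrt r"
      using xb r by (intro AE_I2) (auto simp: indicator_def)
  qed (unfold x_def, measurable)
  have iy: "integrable P (\<lambda>\<omega>. indicator B \<omega> * ((x \<omega>)\<^sup>2 - y \<omega>))"
  proof (rule integrable_const_bound[where B="5 * r"])
    have "norm (indicator B \<omega> * ((x \<omega>)\<^sup>2 - y \<omega>)) \<le> 5 * r" for \<omega>
    proof (cases "\<omega> \<in> B")
      case True
      have "\<bar>x \<omega>\<bar>\<^sup>2 \<le> (2 * sqrt r)\<^sup>2" using xb[OF True] by (intro power_mono) auto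
      then have "(x \<omega>)\<^sup>2 \<le> 4 * r" using r by (simp add: power_mult_distrib)
      then show ?thesis using True yb[OF True] by (simp add: abs_le_iff) (use zero_le_power2[of "x \<omega>"] r in linarith)
    qed (use r in simp)
    then show "AE \<omega> in P. norm (indicator B \<omega> * ((x \<omega>)\<^sup>2 - y \<omega>)) \<le> 5 * r" by simp
  qed (unfold x_def y_def, measurable)
  have zero: "(\<integral>\<omega>. indicator B \<omega> * x \<omega> \<partial>P) = 0" "(\<integral>\<omega>. indicator B \<omega> * ((x \<omega>)\<^sup>2 - y \<omega>) \<partial>P) = 0"
    using increments[OF S T _ B] ST S\<rho> unfolding x_def y_def by auto
  have iB: "integrable P (indicat_real B)"
    using BP by (intro integrable_real_indicator) (auto simp: less_top[symmetric])
  have iAG: "integrable P (indicat_real ?A)" "integrable P (indicat_real ?G)"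
    using AP by (auto intro!: integrable_real_indicator simp: less_top[symmetric] simp del: ex_simps)
  have lin: "(\<integral>\<omega>. p * indicator B \<omega> + q * u \<omega> + s * v \<omega> \<partial>P) = p * prob B + q * (\<integral>\<omega>. u \<omega> \<partial>P) + s * (\<integral>\<omega>. v \<omega> \<partial>P)"
    if "integrable P u" "integrable P v" for p q s :: real and u v
  proof -
    have "integrable P (\<lambda>\<omega>. p * indicator B \<omega> + q * u \<omega>)"
      using that(1) iB by simp
    then show ?thesis using that iB BP by simp
  qed
  have "2 / 25 * prob B = (\<integral>\<omega>. 2 / 25 * indicator B \<omega> + 6 / 25 / sqrt r * (indicator B \<omega> * x \<omega>)
      + 1 / (10 * r) * (indicator B \<omega> * ((x \<omega>)\<^sup>2 - y \<omega>)) \<partial>P)"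
    unfolding lin[OF ix iy] zero by simp
  also have "\<dots> \<le> (\<integral>\<omega>. indicator ?A \<omega> + indicator ?G \<omega> \<partial>P)"
  proof (rule integral_mono)
    show "integrable P (\<lambda>\<omega>. 2 / 25 * indicator B \<omega> + 6 / 25 / sqrt r * (indicator B \<omega> * x \<omega>)
      + 1 / (10 * r) * (indicator B \<omega> * ((x \<omega>)\<^sup>2 - y \<omega>)))"
      using ix iy iB by (intro Bochner_Integration.integrable_add integrable_mult_right)
    show "integrable P (\<lambda>\<omega>. indicator ?A \<omega> + indicator ?G \<omega> :: real)" using iAG by (rule Bochner_Integration.integrable_add)
    fix \<omega> assume \<omega>: "\<omega> \<in> space P"
    show "2 / 25 * indicator B \<omega> + 6 / 25 / sqrt r * (indicator B \<omega> * x \<omega>)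
      + 1 / (10 * r) * (indicator B \<omega> * ((x \<omega>)\<^sup>2 - y \<omega>)) \<le> indicator ?A \<omega> + indicator ?G \<omega>"
    proof (cases "\<omega> \<in> B")
      case True
      have sr: "0 < sqrt r" "(sqrt r)\<^sup>2 = r" using r by simp_all
      have "2 / 25 + 6 / 25 * (x \<omega> / sqrt r) + ((x \<omega> / sqrt r)\<^sup>2 - y \<omega> / r) / 10
        \<le> of_bool (1 / 16 < x \<omega> / sqrt r) + of_bool (\<omega> \<in> ?G)"
      proof (rule step_inequality)
        show "\<bar>x \<omega> / sqrt r\<bar> \<le> 2" using xb[OF True] sr by (simp add: abs_divide pos_divide_le_eq)
        show "0 \<le> y \<omega> / r" "y \<omega> / r \<le> 1" using yb[OF True] r by auto
        \<comment> \<open>If T = \<rho> without either level being reached, then y < r, which says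
          precisely that the clock at \<rho> is below its value at S plus r.\<close>
        have "\<bar>x \<omega>\<bar> = 2 * sqrt r \<or> y \<omega> = r \<or> \<omega> \<in> ?G"
          using stop[OF \<omega>] fT[OF \<omega>] yb(2)[OF True] True by (auto simp: x_def y_def)
        then show "\<bar>x \<omega> / sqrt r\<bar> = 2 \<or> y \<omega> / r = 1 \<or> \<omega> \<in> ?G"
          using r by (auto simp: abs_divide)
      qed
      also have "of_bool (1 / 16 < x \<omega> / sqrt r) = (indicator ?A \<omega> :: real)"
        using True sr by (auto simp: x_def indicator_def field_simps)
      also have "2 / 25 + 6 / 25 * (x \<omega> / sqrt r) + ((x \<omega> / sqrt r)\<^sup>2 - y \<omega> / r) / 10
        = 2 / 25 * indicator B \<omega> + 6 / 25 / sqrt r * (indicator B \<omega> * x \<omega>)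
      + 1 / (10 * r) * (indicator B \<omega> * ((x \<omega>)\<^sup>2 - y \<omega>))"
        using True sr by (simp add: power_divide diff_divide_distrib algebra_simps)
      also have "of_bool (\<omega> \<in> ?G) = (indicator ?G \<omega> :: real)" by (simp add: indicator_def)
      finally show ?thesis .
    qed simp
  qed
  also have "\<dots> = prob ?A + prob ?G"
    unfolding Bochner_Integration.integral_add[OF iAG]
    by (simp only: Bochner_Integration.integral_indicator AP[THEN sets.Int_space_eq2])
  finally show "2 / 25 * prob B \<le> prob ?A + prob ?G" .
qed

text \<open>\<open>B\<close> collects the paths on which all m steps succeeded, and it is decided at
  the last step's end, so \<open>one_step\<close> applies again. On it a S + r \<le> (m+1) r \<le> n
  r, so the cut-off event of every step lies in the single event with threshold n r; fixing n
  beforehand keeps this event the same throughout the induction. Each step then costs at most its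
  probability, as earlier errors are only multiplied by 2 / 25.\<close>

lemma iterated_step:
  assumes r: "0 < r" and "m \<le> n"
  shows "\<exists>S B. stopping_time F S \<and> (\<forall>\<omega>\<in>space P. \<sigma> \<omega> \<le> S \<omega> \<and> S \<omega> \<le> \<rho> \<omega>) \<and>
    B \<in> sets (pre_sigma S) \<and> B \<subseteq> B\<^sub>0 \<and>
    (\<forall>\<omega>\<in>B. a (S \<omega>) \<omega> \<le> real m * r \<and> real m * sqrt r / 16 \<le> N (S \<omega>) \<omega>) \<and>
    (2 / 25) ^ m * prob B\<^sub>0 \<le> prob B + real m * prob {\<omega> \<in> B\<^sub>0. a (\<rho> \<omega>) \<omega> < real n * r}"
  using \<open>m \<le> n\<close>
proof (induction m)
  case 0
  have "B\<^sub>0 \<subseteq> space P" using sets.sets_into_space[OF B\<^sub>0] by (simp add: space_pre_sigma)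
  then show ?case
    using \<sigma> bounds B\<^sub>0 start by (intro exI[of _ \<sigma>] exI[of _ B\<^sub>0]) auto
next
  case (Suc m)
  define e where "e = prob {\<omega> \<in> B\<^sub>0. a (\<rho> \<omega>) \<omega> < real n * r}"
  obtain S B where S: "stopping_time F S" and S\<rho>: "\<And>\<omega>. \<omega> \<in> space P \<Longrightarrow> \<sigma> \<omega> \<le> S \<omega> \<and> S \<omega> \<le> \<rho> \<omega>"
    and B: "B \<in> sets (pre_sigma S)" "B \<subseteq> B\<^sub>0"
    and aS: "\<And>\<omega>. \<omega> \<in> B \<Longrightarrow> a (S \<omega>) \<omega> \<le> real m * r" and NS: "\<And>\<omega>. \<omega> \<in> B \<Longrightarrow> real m * sqrt r / 16 \<le> N (S \<omega>) \<omega>"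
    and pB: "(2 / 25) ^ m * prob B\<^sub>0 \<le> prob B + real m * e"
    using Suc.IH[OF Suc_leD[OF Suc.prems]] unfolding e_def by blast
  obtain T where T: "stopping_time F T" and ST: "\<And>\<omega>. \<omega> \<in> space P \<Longrightarrow> S \<omega> \<le> T \<omega> \<and> T \<omega> \<le> \<rho> \<omega>"
    and aT: "\<And>\<omega>. \<omega> \<in> space P \<Longrightarrow> a (T \<omega>) \<omega> \<le> a (S \<omega>) \<omega> + r"
    and pT: "2 / 25 * prob B \<le> prob {\<omega> \<in> B. sqrt r / 16 < N (T \<omega>) \<omega> - N (S \<omega>) \<omega>}
      + prob {\<omega> \<in> B. a (\<rho> \<omega>) \<omega> < a (S \<omega>) \<omega> + r}"
    using one_step[OF S S\<rho> B r] by blast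
  define B' where "B' = {\<omega> \<in> B. sqrt r / 16 < N (T \<omega>) \<omega> - N (S \<omega>) \<omega>}"
  have Bsub: "B \<subseteq> space P" using sets.sets_into_space[OF B(1)] by (simp add: space_pre_sigma)
  have S0: "0 \<le> S \<omega>" and T0: "0 \<le> T \<omega>" and \<rho>0: "0 \<le> \<rho> \<omega>" if "\<omega> \<in> space P" for \<omega>
    using S\<rho>[OF that] ST[OF that] bounds[OF that] by auto
  have B'm: "B' \<in> sets (pre_sigma T)"
  proof -
    have "B \<in> sets (pre_sigma T)" using mono_pre_sigma[OF S T] ST B(1) by blast
    moreover have "(\<lambda>\<omega>. N (T \<omega>) \<omega>) \<in> borel_measurable (pre_sigma T)"
      by (rule cont_adapted_at_stopping_time[OF N T T0])
    moreover have "(\<lambda>\<omega>. N (S \<omega>) \<omega>) \<in> borel_measurable (pre_sigma T)"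
      using ST by (intro pre_sigma_mono[OF S T _ cont_adapted_at_stopping_time[OF N S S0]]) auto
    ultimately have "B \<inter> {\<omega> \<in> space (pre_sigma T). sqrt r / 16 < N (T \<omega>) \<omega> - N (S \<omega>) \<omega>} \<in> sets (pre_sigma T)"
      by measurable
    also have "B \<inter> {\<omega> \<in> space (pre_sigma T). sqrt r / 16 < N (T \<omega>) \<omega> - N (S \<omega>) \<omega>} = B'"
      using Bsub by (auto simp: B'_def space_pre_sigma)
    finally show ?thesis .
  qed
  have B\<^sub>0P: "B\<^sub>0 \<in> sets P" "B\<^sub>0 \<subseteq> space P"
    using B\<^sub>0 subalgebra_pre_sigma[OF \<sigma>] sets.sets_into_space[OF B\<^sub>0] by (auto simp: subalgebra_def space_pre_sigma)
  have "prob {\<omega> \<in> B. a (\<rho> \<omega>) \<omega> < a (S \<omega>) \<omega> + r} \<le> e"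
    unfolding e_def
  proof (rule finite_measure_mono)
    have n: "real m * r + r \<le> real n * r"
      using Suc.prems r by (simp add: distrib_right[of "real m" 1 r, simplified, symmetric])
    show "{\<omega> \<in> B. a (\<rho> \<omega>) \<omega> < a (S \<omega>) \<omega> + r} \<subseteq> {\<omega> \<in> B\<^sub>0. a (\<rho> \<omega>) \<omega> < real n * r}"
      using B(2) aS n by force
    have "(\<lambda>\<omega>. a (\<rho> \<omega>) \<omega>) \<in> borel_measurable P" by (rule at_stopping_time_P[OF a \<rho> \<rho>0])
    then have "B\<^sub>0 \<inter> {\<omega> \<in> space P. a (\<rho> \<omega>) \<omega> < real n * r} \<in> sets P" using B\<^sub>0P by measurable
    also have "B\<^sub>0 \<inter> {\<omega> \<in> space P. a (\<rho> \<omega>) \<omega> < real n * r} = {\<omega> \<in> B\<^sub>0. a (\<rho> \<omega>) \<omega> < real n * r}"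
      using B\<^sub>0P by auto
    finally show "{\<omega> \<in> B\<^sub>0. a (\<rho> \<omega>) \<omega> < real n * r} \<in> events" .
  qed
  with pT have "2 / 25 * prob B \<le> prob B' + e" by (simp add: B'_def)
  moreover have "0 \<le> e" by (simp add: e_def)
  then have "2 / 25 * (real m * e) \<le> real m * e" by simp
  ultimately have "2 / 25 * ((2 / 25) ^ m * prob B\<^sub>0) \<le> prob B' + real (Suc m) * e"
    using pB by (simp add: algebra_simps)
  moreover have "\<sigma> \<omega> \<le> T \<omega> \<and> T \<omega> \<le> \<rho> \<omega>" if "\<omega> \<in> space P" for \<omega> using S\<rho>[OF that] ST[OF that] by auto
  moreover have "a (T \<omega>) \<omega> \<le> real (Suc m) * r \<and> real (Suc m) * sqrt r / 16 \<le> N (T \<omega>) \<omega>" if "\<omega> \<in> B'" for \<omega>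
    using that aT[of \<omega>] aS[of \<omega>] NS[of \<omega>] Bsub by (auto simp: B'_def algebra_simps add_divide_distrib)
  moreover have "B' \<subseteq> B\<^sub>0" using B(2) by (auto simp: B'_def)
  ultimately show ?case
    using T B'm unfolding e_def by (intro exI[of _ T] exI[of _ B']) (auto simp: mult.assoc)
qed

text \<open>Under \<open>bound\<close> the event of m successes is empty, so only the cut-off error
  remains in \<open>iterated_step\<close>. As m depends on c alone, it stays fixed while r tends to
  0.\<close>

lemma no_sqrt_bound:
  assumes c: "0 \<le> c" and bound: "\<And>\<omega> t. \<omega> \<in> B\<^sub>0 \<Longrightarrow> \<sigma> \<omega> \<le> t \<Longrightarrow> t \<le> \<rho> \<omega> \<Longrightarrow> N t \<omega> \<le> c * sqrt (a t \<omega>)"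
    and pos: "\<And>\<omega>. \<omega> \<in> B\<^sub>0 \<Longrightarrow> 0 < a (\<rho> \<omega>) \<omega>"
  shows "prob B\<^sub>0 = 0"
proof -
  have B\<^sub>0P: "B\<^sub>0 \<in> sets P" "B\<^sub>0 \<subseteq> space P"
    using B\<^sub>0 subalgebra_pre_sigma[OF \<sigma>] sets.sets_into_space[OF B\<^sub>0] by (auto simp: subalgebra_def space_pre_sigma)
  obtain m :: nat where "(16 * c)\<^sup>2 < real m" using reals_Archimedean2 by blast
  then have m: "16 * c < sqrt (real m)" using c by (simp add: real_less_rsqrt)
  then have m0: "0 < real m" using c by (metis le_less_trans mult_nonneg_nonneg real_sqrt_gt_0_iff zero_le_numeral)
  define e where "e = (\<lambda>r. prob {\<omega> \<in> B\<^sub>0. a (\<rho> \<omega>) \<omega> < r})"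
  have key: "(2 / 25) ^ m * prob B\<^sub>0 \<le> real m * e (real m * r)" if r: "0 < r" for r
  proof -
    obtain S B where S: "\<And>\<omega>. \<omega> \<in> space P \<Longrightarrow> \<sigma> \<omega> \<le> S \<omega> \<and> S \<omega> \<le> \<rho> \<omega>" and B: "B \<subseteq> B\<^sub>0"
      and aS: "\<And>\<omega>. \<omega> \<in> B \<Longrightarrow> a (S \<omega>) \<omega> \<le> real m * r" and NS: "\<And>\<omega>. \<omega> \<in> B \<Longrightarrow> real m * sqrt r / 16 \<le> N (S \<omega>) \<omega>"
      and pB: "(2 / 25) ^ m * prob B\<^sub>0 \<le> prob B + real m * e (real m * r)"
      using iterated_step[OF r order_refl, of m] unfolding e_def by blast
    have False if \<omega>: "\<omega> \<in> B" for \<omega>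
    proof -
      have "real m * sqrt r / 16 \<le> c * sqrt (a (S \<omega>) \<omega>)"
        using NS[OF \<omega>] bound[of \<omega> "S \<omega>"] S[of \<omega>] \<omega> B B\<^sub>0P(2) by fastforce
      also have "\<dots> \<le> c * sqrt (real m * r)" using aS[OF \<omega>] c by (intro mult_left_mono) auto
      finally have "sqrt (real m) * (sqrt (real m) * sqrt r) \<le> 16 * c * (sqrt (real m) * sqrt r)"
        by (simp add: real_sqrt_mult algebra_simps)
      moreover have "0 < sqrt (real m) * sqrt r" using m0 r by simp
      ultimately show False using m mult_right_le_imp_le[of "sqrt (real m)" "sqrt (real m) * sqrt r" "16 * c"] by linarith
    qed
    then have "B = {}" by blast
    then show ?thesis using pB by simp
  qed
  \<comment> \<open>\<open>key\<close> will be used with r = 1 / (m (n+1)), whose error event is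
    \<open>A n\<close>; by \<open>pos\<close> these events decrease to the empty set.\<close>
  define A where "A = (\<lambda>n. {\<omega> \<in> B\<^sub>0. a (\<rho> \<omega>) \<omega> < 1 / real (Suc n)})"
  have "(\<lambda>n. prob (A n)) \<longlonglongrightarrow> prob (\<Inter>n. A n)"
  proof (rule finite_Lim_measure_decseq)
    have "(\<lambda>\<omega>. a (\<rho> \<omega>) \<omega>) \<in> borel_measurable P"
      by (rule at_stopping_time_P[OF a \<rho>]) (use bounds in force)
    then have "B\<^sub>0 \<inter> {\<omega> \<in> space P. a (\<rho> \<omega>) \<omega> < 1 / real (Suc n)} \<in> sets P" for n using B\<^sub>0P by measurable
    moreover have "B\<^sub>0 \<inter> {\<omega> \<in> space P. a (\<rho> \<omega>) \<omega> < 1 / real (Suc n)} = A n" for n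
      using B\<^sub>0P by (auto simp: A_def)
    ultimately show "range A \<subseteq> events" by auto
    show "decseq A"
      unfolding decseq_Suc_iff by (auto simp: A_def elim!: order_less_le_trans intro!: divide_left_mono)
  qed
  moreover have "(\<Inter>n. A n) = {}"
  proof -
    have False if "\<omega> \<in> (\<Inter>n. A n)" for \<omega>
    proof -
      have "0 < a (\<rho> \<omega>) \<omega>" using that pos by (auto simp: A_def)
      then obtain n where "inverse (real (Suc n)) < a (\<rho> \<omega>) \<omega>" using reals_Archimedean by blast
      moreover have "a (\<rho> \<omega>) \<omega> < 1 / real (Suc n)" using that by (auto simp: A_def)
      ultimately show False by (simp add: inverse_eq_divide)
    qed
    then show ?thesis by blast
  qed
  ultimately have "(\<lambda>n. real m * prob (A n)) \<longlonglongrightarrow> 0"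
    using tendsto_mult_right_zero by fastforce
  moreover have "(2 / 25) ^ m * prob B\<^sub>0 \<le> real m * prob (A n)" for n
    using key[of "1 / real (Suc n) / real m"] m0 by (simp add: e_def A_def)
  ultimately have "(2 / 25) ^ m * prob B\<^sub>0 \<le> 0"
    by (intro LIMSEQ_le_const) auto
  then show ?thesis using measure_nonneg[of P B\<^sub>0] zero_less_power[of "2 / 25 :: real" m]
    by (simp add: mult_le_0_iff not_le[symmetric])
qed

end

context usual_filtered_prob_space
begin

section \<open>Localization\<close>

text \<open>By completeness the exceptional set is itself a null set, hence in \<open>F 0\<close>.
  This covers properties of no evident measurability, such as the existence of a pathwise
  constant.\<close>

lemma AE_imp_sets_F:
  assumes "AE \<omega> in P. R \<omega>" "0 \<le> t"
  shows "{\<omega> \<in> space P. R \<omega>} \<in> sets (F t)"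
proof -
  obtain A where A: "{\<omega> \<in> space P. \<not> R \<omega>} \<subseteq> A" "A \<in> null_sets P"
    using assms(1) by (auto elim!: AE_E intro: null_setsI)
  then have "{\<omega> \<in> space P. \<not> R \<omega>} \<in> null_sets P" by (rule complete2)
  then have "{\<omega> \<in> space P. \<not> R \<omega>} \<in> sets (F 0)" using null_sets_F by blast
  then have "{\<omega> \<in> space P. \<not> R \<omega>} \<in> sets (F t)" using sets_F_mono[OF assms(2)] by blast
  then have "space (F t) - {\<omega> \<in> space P. \<not> R \<omega>} \<in> sets (F t)" by (rule sets.compl_sets)
  also have "space (F t) - {\<omega> \<in> space P. \<not> R \<omega>} = {\<omega> \<in> space P. R \<omega>}" by (auto simp: space_F)
  finally show ?thesis .
qed

lemma AE_imp_sets_pre_sigma: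
  assumes "AE \<omega> in P. R \<omega>" "stopping_time F T" "\<And>\<omega>. \<omega> \<in> space P \<Longrightarrow> 0 \<le> T \<omega>"
  shows "{\<omega> \<in> space P. R \<omega>} \<in> sets (pre_sigma T)"
proof (rule sets_pre_sigmaI[OF assms(2)])
  fix t :: real
  show "{\<omega> \<in> {\<omega> \<in> space P. R \<omega>}. T \<omega> \<le> t} \<in> sets (F t)"
  proof (cases "0 \<le> t")
    case True
    have "{\<omega> \<in> space P. R \<omega>} \<inter> {\<omega> \<in> space (F t). T \<omega> \<le> t} \<in> sets (F t)"
      using AE_imp_sets_F[OF assms(1) True] stopping_timeD[OF assms(2), of t] by (auto simp: pred_def)
    also have "{\<omega> \<in> space P. R \<omega>} \<inter> {\<omega> \<in> space (F t). T \<omega> \<le> t} = {\<omega> \<in> {\<omega> \<in> space P. R \<omega>}. T \<omega> \<le> t}"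
      by (auto simp: space_F)
    finally show ?thesis .
  next
    case False
    then have "{\<omega> \<in> {\<omega> \<in> space P. R \<omega>}. T \<omega> \<le> t} = {}" using assms(3) by force
    then show ?thesis by (simp only: sets.empty_sets)
  qed
qed

lemma stopping_time_Min:
  assumes "finite I" "I \<noteq> {}" "\<And>i. i \<in> I \<Longrightarrow> stopping_time F (T i)"
  shows "stopping_time F (\<lambda>\<omega>. Min ((\<lambda>i. T i \<omega>) ` I))"
proof (rule stopping_timeI)
  fix t
  have "Measurable.pred (F t) (\<lambda>\<omega>. \<exists>i\<in>I. T i \<omega> \<le> t)"
    using assms(1,3) by (intro measurable_pred_countable stopping_timeD) (auto intro: countable_finite)
  then show "Measurable.pred (F t) (\<lambda>\<omega>. Min ((\<lambda>i. T i \<omega>) ` I) \<le> t)"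
    using assms(1,2) by (simp add: Min_le_iff)
qed

text \<open>Localizing times may be infinite, whereas \<open>stopping_time F\<close> concerns
  real-valued times; the cap at \<open>K\<close> makes the passage to the reals lossless, as the
  last part records.\<close>

lemma stopping_time_truncate:
  assumes \<tau>: "ext_stopping_time P F \<tau>" and K: "0 \<le> K"
  shows "stopping_time F (\<lambda>\<omega>. real_of_ereal (min (ereal K) (\<tau> \<omega>)))"
    and "\<And>\<omega>. \<omega> \<in> space P \<Longrightarrow> 0 \<le> real_of_ereal (min (ereal K) (\<tau> \<omega>))"
    and "\<And>\<omega>. \<omega> \<in> space P \<Longrightarrow> ereal (real_of_ereal (min (ereal K) (\<tau> \<omega>))) = min (ereal K) (\<tau> \<omega>)"
proof -
  have \<tau>0: "0 \<le> \<tau> \<omega>" if "\<omega> \<in> space P" for \<omega> using \<tau> that by (auto simp: ext_stopping_time_def)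
  show 1: "ereal (real_of_ereal (min (ereal K) (\<tau> \<omega>))) = min (ereal K) (\<tau> \<omega>)" if "\<omega> \<in> space P" for \<omega>
    using \<tau>0[OF that] by (cases "\<tau> \<omega>") (auto simp: min_def)
  show nn: "0 \<le> real_of_ereal (min (ereal K) (\<tau> \<omega>))" if "\<omega> \<in> space P" for \<omega>
    using \<tau>0[OF that] K by (intro real_of_ereal_pos) (auto simp: min_def)
  show "stopping_time F (\<lambda>\<omega>. real_of_ereal (min (ereal K) (\<tau> \<omega>)))"
  proof (rule stopping_timeI)
    fix t
    have iff: "real_of_ereal (min (ereal K) (\<tau> \<omega>)) \<le> t \<longleftrightarrow> K \<le> t \<or> \<tau> \<omega> \<le> ereal t" if "\<omega> \<in> space P" for \<omega>
    proof -
      have "real_of_ereal (min (ereal K) (\<tau> \<omega>)) \<le> t \<longleftrightarrow> ereal (real_of_ereal (min (ereal K) (\<tau> \<omega>))) \<le> ereal t"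
        by simp
      then show ?thesis unfolding 1[OF that] by (auto simp: min_le_iff_disj)
    qed
    show "Measurable.pred (F t) (\<lambda>\<omega>. real_of_ereal (min (ereal K) (\<tau> \<omega>)) \<le> t)"
    proof (cases "0 \<le> t")
      case True
      then have "Measurable.pred (F t) (\<lambda>\<omega>. K \<le> t \<or> \<tau> \<omega> \<le> ereal t)"
        using \<tau> by (intro pred_intros_logic) (auto simp: ext_stopping_time_def)
      then show ?thesis
        by (rule measurable_cong[THEN iffD1, rotated]) (simp add: iff space_F)
    next
      case False
      then have "{\<omega> \<in> space (F t). real_of_ereal (min (ereal K) (\<tau> \<omega>)) \<le> t} = {}"
        using nn by (force simp: space_F)
      then show ?thesis unfolding pred_def by (simp only: sets.empty_sets)
    qed
  qed
qed

text \<open>Where g is nonzero, S and T come no later than \<tau>, so the stopped martingale has the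
  same increment as Z and the initial value cancels. As g is known at S, hence also at T, optional
  stopping applies at both times and gives the same integral at K + 1. All bounds are asked only on
  the support of g.\<close>

lemma local_martingale_increment:
  assumes Z: "cont_adapted Z" and \<tau>: "ext_stopping_time P F \<tau>"
    and V: "martingale P F (\<lambda>t \<omega>. stopped \<tau> Z t \<omega> - Z 0 \<omega>)"
    and S: "stopping_time F S" and T: "stopping_time F T"
    and ST: "\<And>\<omega>. \<omega> \<in> space P \<Longrightarrow> 0 \<le> S \<omega> \<and> S \<omega> \<le> T \<omega> \<and> T \<omega> \<le> K"
    and g: "g \<in> borel_measurable (pre_sigma S)" and C: "\<And>\<omega>. \<omega> \<in> space P \<Longrightarrow> \<bar>g \<omega>\<bar> \<le> C"
    and g_supp: "\<And>\<omega>. \<omega> \<in> space P \<Longrightarrow> g \<omega> \<noteq> 0 \<Longrightarrow>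
      ereal (T \<omega>) \<le> \<tau> \<omega> \<and> \<bar>Z 0 \<omega>\<bar> \<le> L \<and> \<bar>Z (S \<omega>) \<omega>\<bar> \<le> L \<and> \<bar>Z (T \<omega>) \<omega>\<bar> \<le> L" and L: "0 \<le> L"
  shows "integrable P (\<lambda>\<omega>. g \<omega> * (Z (T \<omega>) \<omega> - Z (S \<omega>) \<omega>))"
    and "(\<integral>\<omega>. g \<omega> * (Z (T \<omega>) \<omega> - Z (S \<omega>) \<omega>) \<partial>P) = 0"
proof -
  let ?V = "\<lambda>t \<omega>. stopped \<tau> Z t \<omega> - Z 0 \<omega>"
  have T0: "0 \<le> T \<omega>" and S0: "0 \<le> S \<omega>" if "\<omega> \<in> space P" for \<omega> using ST[OF that] by auto
  have Vc: "cont_adapted ?V"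
  proof -
    have "continuous_on {0..} (\<lambda>t. ?V t \<omega>)" if "\<omega> \<in> space P" for \<omega>
    proof -
      note Zc = cont_adaptedD(2)[OF Z that]
      have "0 \<le> \<tau> \<omega>" using \<tau> that by (auto simp: ext_stopping_time_def)
      then show ?thesis
      proof (cases "\<tau> \<omega>")
        case (real u)
        then have "stopped \<tau> Z t \<omega> = Z (min t u) \<omega>" for t by (simp add: stopped_def min_def)
        moreover have "continuous_on {0..} (\<lambda>t. Z (min t u) \<omega>)"
          using \<open>0 \<le> \<tau> \<omega>\<close> real by (intro continuous_on_compose2[OF Zc] continuous_intros) auto
        ultimately show ?thesis by (simp add: continuous_intros)
      next
        case PInf
        then have "stopped \<tau> Z t \<omega> = Z t \<omega>" for t by (simp add: stopped_def min_def)
        then show ?thesis using Zc by (simp add: continuous_intros)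
      qed simp
    qed
    then show ?thesis using V by (auto simp: cont_adapted_def martingale_def)
  qed
  have V_eq: "?V (S \<omega>) \<omega> = Z (S \<omega>) \<omega> - Z 0 \<omega>" "?V (T \<omega>) \<omega> = Z (T \<omega>) \<omega> - Z 0 \<omega>"
    if "\<omega> \<in> space P" "g \<omega> \<noteq> 0" for \<omega>
  proof -
    have "ereal (T \<omega>) \<le> \<tau> \<omega>" using g_supp[OF that] by blast
    moreover from this have "ereal (S \<omega>) \<le> \<tau> \<omega>"
      using ST[OF that(1)] order_trans[of "ereal (S \<omega>)" "ereal (T \<omega>)" "\<tau> \<omega>"] by simp
    ultimately have "min (ereal (T \<omega>)) (\<tau> \<omega>) = ereal (T \<omega>)" "min (ereal (S \<omega>)) (\<tau> \<omega>) = ereal (S \<omega>)"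
      by (simp_all add: min_absorb1)
    then show "?V (S \<omega>) \<omega> = Z (S \<omega>) \<omega> - Z 0 \<omega>" "?V (T \<omega>) \<omega> = Z (T \<omega>) \<omega> - Z 0 \<omega>" by (simp_all add: stopped_def)
  qed
  have gT: "g \<in> borel_measurable (pre_sigma T)"
    using ST by (intro pre_sigma_mono[OF S T _ g]) auto
  have gP: "g \<in> borel_measurable P" by (rule pre_sigma_imp_P[OF S g])
  have ZP: "(\<lambda>\<omega>. Z (R \<omega>) \<omega>) \<in> borel_measurable P" "(\<lambda>\<omega>. ?V (R \<omega>) \<omega>) \<in> borel_measurable P"
    if "R = S \<or> R = T" for R
    using that pre_sigma_imp_P[OF S cont_adapted_at_stopping_time[OF Z S S0]]
      pre_sigma_imp_P[OF T cont_adapted_at_stopping_time[OF Z T T0]]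
      pre_sigma_imp_P[OF S cont_adapted_at_stopping_time[OF Vc S S0]]
      pre_sigma_imp_P[OF T cont_adapted_at_stopping_time[OF Vc T T0]] by auto
  have VT: "(\<integral>\<omega>. g \<omega> * ?V (T \<omega>) \<omega> \<partial>P) = (\<integral>\<omega>. g \<omega> * ?V (K + 1) \<omega> \<partial>P)"
  proof (rule optional_stopping_bounded[OF V Vc T _ order_refl gT C, where L="2 * L"])
    fix \<omega> assume "\<omega> \<in> space P" "g \<omega> \<noteq> 0"
    then show "\<bar>?V (T \<omega>) \<omega>\<bar> \<le> 2 * L" using V_eq[of \<omega>] g_supp[of \<omega>] by (simp add: abs_le_iff)
  qed (use ST T0 in auto)
  have VS: "(\<integral>\<omega>. g \<omega> * ?V (S \<omega>) \<omega> \<partial>P) = (\<integral>\<omega>. g \<omega> * ?V (K + 1) \<omega> \<partial>P)"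
  proof (rule optional_stopping_bounded[OF V Vc S _ order_refl g C, where L="2 * L"])
    fix \<omega> assume "\<omega> \<in> space P" "g \<omega> \<noteq> 0"
    then show "\<bar>?V (S \<omega>) \<omega>\<bar> \<le> 2 * L" using V_eq[of \<omega>] g_supp[of \<omega>] by (simp add: abs_le_iff)
  qed (use ST in force)+
  have int: "integrable P (\<lambda>\<omega>. g \<omega> * ?V (R \<omega>) \<omega>)" if R: "R = S \<or> R = T" for R
  proof (rule integrable_const_bound[where B="C * (2 * L)"])
    show "AE \<omega> in P. norm (g \<omega> * ?V (R \<omega>) \<omega>) \<le> C * (2 * L)"
    proof (rule AE_I2)
      fix \<omega> assume \<omega>: "\<omega> \<in> space P"
      show "norm (g \<omega> * ?V (R \<omega>) \<omega>) \<le> C * (2 * L)"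
      proof (cases "g \<omega> = 0")
        case True
        then show ?thesis using C[OF \<omega>] L by simp
      next
        case False
        then have "\<bar>?V (R \<omega>) \<omega>\<bar> \<le> 2 * L" using R V_eq[OF \<omega>] g_supp[OF \<omega>] by (auto simp: abs_le_iff)
        then show ?thesis using C[OF \<omega>] by (auto simp: abs_mult intro!: mult_mono)
      qed
    qed
  qed (use gP ZP(2)[OF R] in measurable)
  have eq: "g \<omega> * (Z (T \<omega>) \<omega> - Z (S \<omega>) \<omega>) = g \<omega> * ?V (T \<omega>) \<omega> - g \<omega> * ?V (S \<omega>) \<omega>"
    if "\<omega> \<in> space P" for \<omega>
    using V_eq[OF that] by (cases "g \<omega> = 0") (auto simp: algebra_simps)
  have "integrable P (\<lambda>\<omega>. g \<omega> * ?V (T \<omega>) \<omega> - g \<omega> * ?V (S \<omega>) \<omega>)" using int by simp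
  then show "integrable P (\<lambda>\<omega>. g \<omega> * (Z (T \<omega>) \<omega> - Z (S \<omega>) \<omega>))"
    by (rule Bochner_Integration.integrable_cong[THEN iffD1, rotated 2]) (simp_all add: eq)
  have "(\<integral>\<omega>. g \<omega> * (Z (T \<omega>) \<omega> - Z (S \<omega>) \<omega>) \<partial>P) = (\<integral>\<omega>. g \<omega> * ?V (T \<omega>) \<omega> - g \<omega> * ?V (S \<omega>) \<omega> \<partial>P)"
    by (rule Bochner_Integration.integral_cong) (simp_all add: eq)
  also have "\<dots> = 0" using int VT VS by simp
  finally show "(\<integral>\<omega>. g \<omega> * (Z (T \<omega>) \<omega> - Z (S \<omega>) \<omega>) \<partial>P) = 0" .
qed

section \<open>The projected martingale and its clock\<close>

text \<open>The increment vanishes before \<sigma>, so g can be cut off outside {\<sigma> \<le> t},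
  where it need not yet be known.\<close>

lemma cont_adapted_increment_after:
  assumes Z: "cont_adapted Z" and \<sigma>: "stopping_time F \<sigma>" and \<sigma>0: "\<And>\<omega>. \<omega> \<in> space P \<Longrightarrow> 0 \<le> \<sigma> \<omega>"
    and g: "g \<in> borel_measurable (pre_sigma \<sigma>)"
  shows "cont_adapted (\<lambda>t \<omega>. g \<omega> * (Z (max t (\<sigma> \<omega>)) \<omega> - Z (\<sigma> \<omega>) \<omega>))"
  unfolding cont_adapted_def adapted_def
proof (intro conjI allI impI ballI)
  fix t :: real assume t: "0 \<le> t"
  have "(\<lambda>\<omega>. (if \<sigma> \<omega> \<le> t then g \<omega> else 0) * (Z t \<omega> - Z (min t (\<sigma> \<omega>)) \<omega>)) \<in> borel_measurable (F t)"
    by (intro borel_measurable_times borel_measurable_diff pre_sigma_restrict_measurable \<sigma> g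
        cont_adaptedD(1)[OF Z] cont_adapted_stopped_measurable Z \<sigma>0 t)
  also have "(\<lambda>\<omega>. (if \<sigma> \<omega> \<le> t then g \<omega> else 0) * (Z t \<omega> - Z (min t (\<sigma> \<omega>)) \<omega>))
      = (\<lambda>\<omega>. g \<omega> * (Z (max t (\<sigma> \<omega>)) \<omega> - Z (\<sigma> \<omega>) \<omega>))"
    by (auto simp: fun_eq_iff max_def min_def)
  finally show "(\<lambda>\<omega>. g \<omega> * (Z (max t (\<sigma> \<omega>)) \<omega> - Z (\<sigma> \<omega>) \<omega>)) \<in> borel_measurable (F t)" .
next
  fix \<omega> assume \<omega>: "\<omega> \<in> space P"
  show "continuous_on {0..} (\<lambda>t. g \<omega> * (Z (max t (\<sigma> \<omega>)) \<omega> - Z (\<sigma> \<omega>) \<omega>))"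
    using \<sigma>0[OF \<omega>]
    by (intro continuous_intros continuous_on_compose2[OF cont_adaptedD(2)[OF Z \<omega>]]) auto
qed

section \<open>Closure properties of continuous adapted processes\<close>

lemma cont_adapted_sum:
  assumes "\<And>i. i \<in> I \<Longrightarrow> cont_adapted (Z i)"
  shows "cont_adapted (\<lambda>t \<omega>. \<Sum>i\<in>I. Z i t \<omega>)"
  using assms by (auto simp: cont_adapted_def adapted_def intro!: continuous_on_sum borel_measurable_sum)

lemma cont_adapted_abs: "cont_adapted Z \<Longrightarrow> cont_adapted (\<lambda>t \<omega>. \<bar>Z t \<omega>\<bar>)"
  by (auto simp: cont_adapted_def adapted_def intro!: continuous_intros borel_measurable_abs)

lemma cont_adapted_add: "cont_adapted Z \<Longrightarrow> cont_adapted W \<Longrightarrow> cont_adapted (\<lambda>t \<omega>. Z t \<omega> + W t \<omega>)"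
  by (auto simp: cont_adapted_def adapted_def intro!: continuous_intros borel_measurable_add)

lemma cont_adapted_diff: "cont_adapted Z \<Longrightarrow> cont_adapted W \<Longrightarrow> cont_adapted (\<lambda>t \<omega>. Z t \<omega> - W t \<omega>)"
  by (auto simp: cont_adapted_def adapted_def intro!: continuous_intros borel_measurable_diff)

lemma cont_adapted_mult: "cont_adapted Z \<Longrightarrow> cont_adapted W \<Longrightarrow> cont_adapted (\<lambda>t \<omega>. Z t \<omega> * W t \<omega>)"
  by (auto simp: cont_adapted_def adapted_def intro!: continuous_intros borel_measurable_times)

lemma cont_adapted_minus_sqrt:
  "cont_adapted Z \<Longrightarrow> cont_adapted W \<Longrightarrow> cont_adapted (\<lambda>t \<omega>. Z t \<omega> - c * sqrt (W t \<omega>))"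
  by (auto simp: cont_adapted_def adapted_def
      intro!: continuous_intros borel_measurable_diff borel_measurable_times
        measurable_compose[OF _ borel_measurable_sqrt])

text \<open>Frozen at 0 until \<sigma> by \<open>max\<close>: this makes it adapted from time 0 on
  although H is known only at \<sigma>.\<close>

definition projected :: "(real \<Rightarrow> 'a \<Rightarrow> real^'d) \<Rightarrow> ('a \<Rightarrow> real) \<Rightarrow> ('a \<Rightarrow> real^'d) \<Rightarrow> real \<Rightarrow> 'a \<Rightarrow> real" where
  "projected M \<sigma> H t \<omega> = (\<Sum>d\<in>UNIV. H \<omega> $ d * (M (max t (\<sigma> \<omega>)) \<omega> $ d - M (\<sigma> \<omega>) \<omega> $ d))"

text \<open>The quadratic form of H in the increment of Q since \<sigma>, that is, the bracket of
  \<open>projected\<close> when Q is that of M. The coordinate form exhibits it as a finite sum of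
  weighted scalar increments.\<close>

definition projected_clock :: "(real \<Rightarrow> 'a \<Rightarrow> real^'d^'d) \<Rightarrow> ('a \<Rightarrow> real) \<Rightarrow> ('a \<Rightarrow> real^'d) \<Rightarrow> real \<Rightarrow> 'a \<Rightarrow> real" where
  "projected_clock Q \<sigma> H t \<omega> =
     (\<Sum>d\<in>UNIV. \<Sum>q\<in>UNIV. H \<omega> $ d * H \<omega> $ q * (Q (max t (\<sigma> \<omega>)) \<omega> $ d $ q - Q (\<sigma> \<omega>) \<omega> $ d $ q))"

lemma projected_eq_inner:
  "\<sigma> \<omega> \<le> t \<Longrightarrow> projected M \<sigma> H t \<omega> = H \<omega> \<bullet> (M t \<omega> - M (\<sigma> \<omega>) \<omega>)"
  by (simp add: projected_def inner_vec_def max_def)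

lemma projected_clock_increment:
  "\<sigma> \<omega> \<le> s \<Longrightarrow> s \<le> t \<Longrightarrow>
   projected_clock Q \<sigma> H t \<omega> - projected_clock Q \<sigma> H s \<omega> = H \<omega> \<bullet> ((Q t \<omega> - Q s \<omega>) *v H \<omega>)"
  by (simp add: projected_clock_def inner_vec_def matrix_vector_mult_def max_absorb1 sum_distrib_left
      sum_subtractf[symmetric] algebra_simps)

text \<open>Tests the matrix inequality on the vector H, whose unit length turns the identity matrix
  into the number 1.\<close>

lemma projected_clock_increment_ge:
  assumes "\<sigma> \<omega> \<le> s" "s \<le> t" "psd_le ((\<epsilon> * (t - s)) *\<^sub>R mat 1) (Q t \<omega> - Q s \<omega>)" "norm (H \<omega>) = 1"
  shows "\<epsilon> * (t - s) \<le> projected_clock Q \<sigma> H t \<omega> - projected_clock Q \<sigma> H s \<omega>"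
proof -
  have "0 \<le> H \<omega> \<bullet> ((Q t \<omega> - Q s \<omega> - (\<epsilon> * (t - s)) *\<^sub>R mat 1) *v H \<omega>)"
    using assms(3) by (simp add: psd_le_def)
  also have "\<dots> = H \<omega> \<bullet> ((Q t \<omega> - Q s \<omega>) *v H \<omega>) - \<epsilon> * (t - s) * (H \<omega> \<bullet> H \<omega>)"
    by (simp add: matrix_vector_mult_diff_rdistrib scaleR_matrix_vector_assoc[symmetric] inner_diff_right)
  also have "H \<omega> \<bullet> H \<omega> = 1" using assms(4) by (simp add: dot_square_norm)
  finally show ?thesis using projected_clock_increment[of \<sigma> \<omega> s t Q H] assms(1,2) by simp
qed

text \<open>Let \<nu> be the first time at which N exceeds c sqrt a. If \<nu> came after \<sigma>
  with positive probability, so would some localized time \<open>\<kappa> n\<close>, and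
  \<open>no_sqrt_bound\<close> on the event {\<sigma> < \<open>\<kappa> n\<close>} would be
  contradicted.\<close>

lemma projected_exceeds_sqrt_clock:
  fixes M :: "real \<Rightarrow> 'a \<Rightarrow> real^'d" and Q :: "real \<Rightarrow> 'a \<Rightarrow> real^'d^'d"
  assumes Mc: "\<And>d. cont_adapted (\<lambda>t \<omega>. M t \<omega> $ d)"
    and Qc: "\<And>d q. cont_adapted (\<lambda>t \<omega>. Q t \<omega> $ d $ q)"
    and M_loc: "\<And>d. continuous_local_martingale P F (\<lambda>t \<omega>. M t \<omega> $ d)"
    and Q_loc: "\<And>d q. continuous_local_martingale P F (\<lambda>t \<omega>. M t \<omega> $ d * M t \<omega> $ q - Q t \<omega> $ d $ q)"
    and \<sigma>: "stopping_time F \<sigma>" and \<sigma>K: "\<And>\<omega>. \<omega> \<in> space P \<Longrightarrow> 0 \<le> \<sigma> \<omega> \<and> \<sigma> \<omega> \<le> K" and K: "0 \<le> K"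
    and H: "H \<in> borel_measurable (pre_sigma \<sigma>)" "AE \<omega> in P. norm (H \<omega>) = 1"
    and ell: "AE \<omega> in P. \<exists>\<epsilon>>0. \<forall>s t. 0 \<le> s \<and> s \<le> t \<and> t \<le> K + 1 \<longrightarrow>
       psd_le ((\<epsilon> * (t - s)) *\<^sub>R mat 1) (Q t \<omega> - Q s \<omega>)"
    and c: "0 \<le> c"
  shows "AE \<omega> in P. \<forall>\<eta>>0. \<exists>t. \<sigma> \<omega> < t \<and> t < \<sigma> \<omega> + \<eta> \<and> t < K + 1 \<and>
     c * sqrt (projected_clock Q \<sigma> H t \<omega>) < projected M \<sigma> H t \<omega>"
proof -
  \<comment> \<open>One family for the \<open>M\<^sup>q\<close> (index \<open>(None, q)\<close>) and the \<open>M\<^sup>d M\<^sup>q - Q\<^sup>d\<^sup>q\<close> (index \<open>(Some d, q)\<close>), to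
    localize all of them at once.\<close>
  define Z where "Z = (\<lambda>(i :: 'd option \<times> 'd) t \<omega>. case fst i of None \<Rightarrow> M t \<omega> $ snd i
    | Some d \<Rightarrow> M t \<omega> $ d * M t \<omega> $ snd i - Q t \<omega> $ d $ snd i)"
  have Z_simps: "Z (None, q) = (\<lambda>t \<omega>. M t \<omega> $ q)"
    "Z (Some d, q) = (\<lambda>t \<omega>. M t \<omega> $ d * M t \<omega> $ q - Q t \<omega> $ d $ q)" for d q
    by (simp_all add: Z_def)
  have Zc: "cont_adapted (Z i)" and Zl: "continuous_local_martingale P F (Z i)" for i
    by (cases i; cases "fst i"; auto simp: Z_simps intro!: cont_adapted_diff cont_adapted_mult Mc Qc M_loc Q_loc)+
  have "\<forall>i. \<exists>\<tau>. (\<forall>n::nat. ext_stopping_time P F (\<tau> n)) \<and>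
          (AE \<omega> in P. incseq (\<lambda>n. \<tau> n \<omega>) \<and> (\<lambda>n. \<tau> n \<omega>) \<longlonglongrightarrow> \<infinity>) \<and>
          (\<forall>n. martingale P F (\<lambda>t \<omega>. stopped (\<tau> n) (Z i) t \<omega> - Z i 0 \<omega>))"
    using Zl unfolding continuous_local_martingale_def by blast
  from choice[OF this] obtain \<tau> where \<tau>_all: "\<And>i. (\<forall>n::nat. ext_stopping_time P F (\<tau> i n)) \<and>
          (AE \<omega> in P. incseq (\<lambda>n. \<tau> i n \<omega>) \<and> (\<lambda>n. \<tau> i n \<omega>) \<longlonglongrightarrow> \<infinity>) \<and>
          (\<forall>n. martingale P F (\<lambda>t \<omega>. stopped (\<tau> i n) (Z i) t \<omega> - Z i 0 \<omega>))"
    by blast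
  then have \<tau>: "ext_stopping_time P F (\<tau> i n)"
    and \<tau>_mart: "martingale P F (\<lambda>t \<omega>. stopped (\<tau> i n) (Z i) t \<omega> - Z i 0 \<omega>)" for i n
    by blast+
  have \<tau>_lim: "AE \<omega> in P. (\<lambda>n. \<tau> i n \<omega>) \<longlonglongrightarrow> \<infinity>" for i
    using \<tau>_all[of i] by (auto elim: AE_mp)
  \<comment> \<open>The extra unit leaves room after \<sigma>, which may equal K.\<close>
  define K\<^sub>1 where "K\<^sub>1 = K + 1"
  have K\<^sub>1: "0 \<le> K\<^sub>1" "K < K\<^sub>1" using K by (auto simp: K\<^sub>1_def)
  let ?N = "projected M \<sigma> H" and ?a = "projected_clock Q \<sigma> H"
  have \<sigma>0: "0 \<le> \<sigma> \<omega>" if "\<omega> \<in> space P" for \<omega> using \<sigma>K[OF that] by simp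
  have Hm: "(\<lambda>\<omega>. H \<omega> $ d) \<in> borel_measurable (pre_sigma \<sigma>)" for d
    by (rule measurable_compose[OF H(1) borel_measurable_continuous_onI]) (intro continuous_intros)
  have Nc: "cont_adapted ?N"
    unfolding projected_def by (intro cont_adapted_sum cont_adapted_increment_after[OF Mc \<sigma> \<sigma>0 Hm])
  have ac: "cont_adapted ?a"
    unfolding projected_clock_def
    by (intro cont_adapted_sum cont_adapted_increment_after[OF Qc \<sigma> \<sigma>0] borel_measurable_times Hm)
  have before_start: "?N t \<omega> = 0" "?a t \<omega> = 0" if "t \<le> \<sigma> \<omega>" for t \<omega>
    using that by (simp_all add: projected_def projected_clock_def max_absorb2)
  \<comment> \<open>The library's \<open>sqrt\<close> is odd and continuous on all reals, so f has
    continuous paths even where the clock is negative on an exceptional set.\<close>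
  define f where "f = (\<lambda>t \<omega>. ?N t \<omega> - c * sqrt (?a t \<omega>))"
  have fc: "cont_adapted f" unfolding f_def by (intro cont_adapted_minus_sqrt Nc ac)
  \<comment> \<open>One process dominating all components of M and Q, so that a single hitting time
    bounds them all.\<close>
  define U where "U = (\<lambda>t \<omega>. (\<Sum>d\<in>UNIV. \<bar>M t \<omega> $ d\<bar>) + (\<Sum>d\<in>UNIV. \<Sum>q\<in>UNIV. \<bar>Q t \<omega> $ d $ q\<bar>))"
  have Uc: "cont_adapted U"
    unfolding U_def by (intro cont_adapted_add cont_adapted_sum cont_adapted_abs Mc Qc)
  have U_M: "\<bar>M t \<omega> $ d\<bar> \<le> U t \<omega>" and U_Q: "\<bar>Q t \<omega> $ d $ q\<bar> \<le> U t \<omega>" for t \<omega> d q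
  proof -
    have 0: "0 \<le> (\<Sum>d\<in>UNIV. \<bar>M t \<omega> $ d\<bar>)" "0 \<le> (\<Sum>d\<in>UNIV. \<Sum>q\<in>UNIV. \<bar>Q t \<omega> $ d $ q\<bar>)"
      by (auto intro!: sum_nonneg)
    have "\<bar>M t \<omega> $ d\<bar> \<le> (\<Sum>d\<in>UNIV. \<bar>M t \<omega> $ d\<bar>)"
      by (rule member_le_sum) auto
    then show "\<bar>M t \<omega> $ d\<bar> \<le> U t \<omega>" using 0 unfolding U_def by linarith
    have "\<bar>Q t \<omega> $ d $ q\<bar> \<le> (\<Sum>q\<in>UNIV. \<bar>Q t \<omega> $ d $ q\<bar>)"
      by (rule member_le_sum) auto
    also have "\<dots> \<le> (\<Sum>d\<in>UNIV. \<Sum>q\<in>UNIV. \<bar>Q t \<omega> $ d $ q\<bar>)"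
      by (rule member_le_sum[where f="\<lambda>d. \<Sum>q\<in>UNIV. \<bar>Q t \<omega> $ d $ q\<bar>"]) (auto intro!: sum_nonneg)
    finally show "\<bar>Q t \<omega> $ d $ q\<bar> \<le> U t \<omega>" using 0 unfolding U_def by linarith
  qed
  define \<nu> where "\<nu> = hit f 0 K\<^sub>1"
  define \<theta> where "\<theta> = (\<lambda>n \<omega>. Min ((\<lambda>i. real_of_ereal (min (ereal K\<^sub>1) (\<tau> i n \<omega>))) ` UNIV))"
  define \<kappa> where "\<kappa> = (\<lambda>n \<omega>. min (\<nu> \<omega>) (min (hit U (real n) K\<^sub>1 \<omega>) (\<theta> n \<omega>)))"
  \<comment> \<open>\<open>\<kappa> n\<close> may precede \<sigma>, while the locale asks for
    \<sigma> \<le> \<rho> everywhere; on \<open>B n\<close> the maximum is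
    \<open>\<kappa> n\<close>.\<close>
  define \<rho> where "\<rho> = (\<lambda>n \<omega>. max (\<sigma> \<omega>) (\<kappa> n \<omega>))"
  have \<nu>: "stopping_time F \<nu>" and hU: "stopping_time F (hit U (real n) K\<^sub>1)" and \<theta>: "stopping_time F (\<theta> n)" for n
    using fc Uc K\<^sub>1(1) \<tau> unfolding \<nu>_def \<theta>_def
    by (auto intro!: stopping_time_hit stopping_time_Min stopping_time_truncate(1) simp: cont_adapted_def)
  have \<kappa>: "stopping_time F (\<kappa> n)" for n
    unfolding \<kappa>_def by (intro stopping_time_min \<nu> hU \<theta>)
  have \<rho>: "stopping_time F (\<rho> n)" for n
    unfolding \<rho>_def by (intro stopping_time_max \<sigma> \<kappa>)
  have \<kappa>_le: "\<kappa> n \<omega> \<le> K\<^sub>1" for n \<omega>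
    using hit_bounds(2)[OF K\<^sub>1(1), of f 0 \<omega>] by (simp add: \<kappa>_def \<nu>_def min_le_iff_disj)
  \<comment> \<open>Only the existence of \<epsilon> on each path enters, not its value. So
    \<open>E\<close> is an almost sure event and lies in \<open>pre_sigma \<sigma>\<close> by
    completeness.\<close>
  define E where "E = {\<omega> \<in> space P. norm (H \<omega>) = 1 \<and> (\<exists>\<epsilon>>0. \<forall>s t. 0 \<le> s \<and> s \<le> t \<and> t \<le> K\<^sub>1 \<longrightarrow>
       psd_le ((\<epsilon> * (t - s)) *\<^sub>R mat 1) (Q t \<omega> - Q s \<omega>))}"
  have E: "E \<in> sets (pre_sigma \<sigma>)" "AE \<omega> in P. \<omega> \<in> E"
  proof -
    have ae: "AE \<omega> in P. norm (H \<omega>) = 1 \<and> (\<exists>\<epsilon>>0. \<forall>s t. 0 \<le> s \<and> s \<le> t \<and> t \<le> K\<^sub>1 \<longrightarrow>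
       psd_le ((\<epsilon> * (t - s)) *\<^sub>R mat 1) (Q t \<omega> - Q s \<omega>))"
      using H(2) ell unfolding K\<^sub>1_def by eventually_elim blast
    show "E \<in> sets (pre_sigma \<sigma>)" unfolding E_def by (rule AE_imp_sets_pre_sigma[OF ae \<sigma> \<sigma>0])
    show "AE \<omega> in P. \<omega> \<in> E" using ae AE_space unfolding E_def by eventually_elim blast
  qed
  define B where "B = (\<lambda>n. {\<omega> \<in> E. \<sigma> \<omega> < \<kappa> n \<omega>})"
  have Bm: "B n \<in> sets (pre_sigma \<sigma>)" for n
  proof -
    have "E \<inter> {\<omega> \<in> space (pre_sigma \<sigma>). \<sigma> \<omega> < \<kappa> n \<omega>} \<in> sets (pre_sigma \<sigma>)"
      using E(1) stopping_time_less[OF \<sigma> \<kappa>, of n] unfolding pred_def by blast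
    also have "E \<inter> {\<omega> \<in> space (pre_sigma \<sigma>). \<sigma> \<omega> < \<kappa> n \<omega>} = B n"
      by (auto simp: B_def E_def space_pre_sigma)
    finally show ?thesis .
  qed
  have clock: "\<exists>\<epsilon>>0. \<forall>s t. \<sigma> \<omega> \<le> s \<and> s \<le> t \<and> t \<le> K\<^sub>1 \<longrightarrow> \<epsilon> * (t - s) \<le> ?a t \<omega> - ?a s \<omega>" if "\<omega> \<in> E" for \<omega>
  proof -
    have \<omega>: "\<omega> \<in> space P" "norm (H \<omega>) = 1" using that by (auto simp: E_def)
    obtain \<epsilon> where \<epsilon>: "0 < \<epsilon>" "\<And>s t. 0 \<le> s \<Longrightarrow> s \<le> t \<Longrightarrow> t \<le> K\<^sub>1 \<Longrightarrow>
      psd_le ((\<epsilon> * (t - s)) *\<^sub>R mat 1) (Q t \<omega> - Q s \<omega>)" using \<open>\<omega> \<in> E\<close> by (auto simp: E_def)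
    have "\<epsilon> * (t - s) \<le> ?a t \<omega> - ?a s \<omega>" if "\<sigma> \<omega> \<le> s" "s \<le> t" "t \<le> K\<^sub>1" for s t
      using that \<epsilon>(2)[of s t] \<sigma>0[OF \<omega>(1)] by (intro projected_clock_increment_ge \<omega>) auto
    with \<epsilon>(1) show ?thesis by blast
  qed
  have B_null: "prob (B n) = 0" for n
  proof -
    have B_supp: "\<omega> \<in> space P" "norm (H \<omega>) = 1" "\<rho> n \<omega> = \<kappa> n \<omega>" "\<sigma> \<omega> < \<rho> n \<omega>" "\<omega> \<in> E" if "\<omega> \<in> B n" for \<omega>
      using that by (auto simp: B_def E_def \<rho>_def)
    have U_le: "U t \<omega> \<le> real n" if "\<omega> \<in> B n" "0 \<le> t" "t \<le> \<rho> n \<omega>" for \<omega> t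
    proof -
      note * = B_supp[OF that(1)]
      have le: "t \<le> hit U (real n) K\<^sub>1 \<omega>" and pos: "0 < hit U (real n) K\<^sub>1 \<omega>"
        using * that \<sigma>0[OF *(1)] by (auto simp: \<kappa>_def)
      note Uc' = cont_adaptedD(2)[OF Uc *(1)]
      show ?thesis
      proof (cases "t = hit U (real n) K\<^sub>1 \<omega>")
        case True
        then show ?thesis using not_above_at_hit[where f=U, OF Uc' K\<^sub>1(1)] pos by simp
      next
        case False
        then show ?thesis using not_above_before_hit[where f=U, OF Uc' K\<^sub>1(1) that(2)] le by simp
      qed
    qed
    have Z_le: "\<bar>Z i t \<omega>\<bar> \<le> (real n)\<^sup>2 + real n" if "\<omega> \<in> B n" "0 \<le> t" "t \<le> \<rho> n \<omega>" for \<omega> t i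
    proof -
      have M_n: "\<bar>M t \<omega> $ d\<bar> \<le> real n" and Q_n: "\<bar>Q t \<omega> $ d $ q\<bar> \<le> real n" for d q
        using U_le[OF that] U_M[of t \<omega> d] U_Q[of t \<omega> d q] by linarith+
      show ?thesis
      proof (cases "fst i")
        case None
        then have "\<bar>Z i t \<omega>\<bar> \<le> real n" using M_n by (simp add: Z_def)
        then show ?thesis by (simp add: add_increasing)
      next
        case (Some d)
        have "\<bar>M t \<omega> $ d * M t \<omega> $ snd i\<bar> \<le> real n * real n"
          unfolding abs_mult by (intro mult_mono M_n) auto
        then have "\<bar>M t \<omega> $ d * M t \<omega> $ snd i - Q t \<omega> $ d $ snd i\<bar> \<le> real n * real n + real n"
          using Q_n[of d "snd i"] by linarith
        then show ?thesis using Some by (simp add: Z_def power2_eq_square)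
      qed
    qed
    have \<tau>_ge: "ereal t \<le> \<tau> i n \<omega>" if "\<omega> \<in> B n" "t \<le> \<rho> n \<omega>" for \<omega> t i
    proof -
      have "t \<le> \<theta> n \<omega>" using that B_supp[OF that(1)] by (simp add: \<kappa>_def)
      also have "\<dots> \<le> real_of_ereal (min (ereal K\<^sub>1) (\<tau> i n \<omega>))"
        unfolding \<theta>_def by (rule Min_le) auto
      finally have "ereal t \<le> ereal (real_of_ereal (min (ereal K\<^sub>1) (\<tau> i n \<omega>)))" by simp
      then show ?thesis
        unfolding stopping_time_truncate(3)[OF \<tau> K\<^sub>1(1) B_supp(1)[OF that(1)]] by simp
    qed
    interpret martingale_with_clock P F \<sigma> "\<rho> n" K\<^sub>1 ?N ?a "B n"
    proof
      show "0 \<le> \<sigma> \<omega> \<and> \<sigma> \<omega> \<le> \<rho> n \<omega> \<and> \<rho> n \<omega> \<le> K\<^sub>1" if "\<omega> \<in> space P" for \<omega>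
        using \<sigma>K[OF that] K\<^sub>1 \<kappa>_le[of n \<omega>] by (auto simp: \<rho>_def)
      show "?a s \<omega> \<le> ?a t \<omega>" if "\<omega> \<in> B n" "\<sigma> \<omega> \<le> s" "s \<le> t" "t \<le> \<rho> n \<omega>" for \<omega> s t
      proof -
        have "t \<le> K\<^sub>1" using that \<kappa>_le[of n \<omega>] B_supp(3)[OF that(1)] by simp
        then have "\<exists>\<epsilon>>0. \<epsilon> * (t - s) \<le> ?a t \<omega> - ?a s \<omega>"
          using clock[OF B_supp(5)[OF that(1)]] that(2,3) by blast
        then obtain \<epsilon> where "0 < \<epsilon>" "\<epsilon> * (t - s) \<le> ?a t \<omega> - ?a s \<omega>" by blast
        moreover have "0 \<le> \<epsilon> * (t - s)" using \<open>0 < \<epsilon>\<close> that by simp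
        ultimately show ?thesis by linarith
      qed
      fix S T A
      assume S: "stopping_time F S" and T: "stopping_time F T"
        and ST: "\<And>\<omega>. \<omega> \<in> space P \<Longrightarrow> \<sigma> \<omega> \<le> S \<omega> \<and> S \<omega> \<le> T \<omega> \<and> T \<omega> \<le> \<rho> n \<omega>"
        and A: "A \<in> sets (pre_sigma S)" "A \<subseteq> B n"
      have STK: "0 \<le> S \<omega> \<and> S \<omega> \<le> T \<omega> \<and> T \<omega> \<le> K\<^sub>1" if "\<omega> \<in> space P" for \<omega>
        using ST[OF that] \<sigma>K[OF that] K\<^sub>1 \<kappa>_le[of n \<omega>] by (auto simp: \<rho>_def)
      have S0: "0 \<le> S \<omega>" if "\<omega> \<in> space P" for \<omega> using STK[OF that] by simp
      have inc: "integrable P (\<lambda>\<omega>. indicator A \<omega> * g \<omega> * (Z i (T \<omega>) \<omega> - Z i (S \<omega>) \<omega>))"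
        "(\<integral>\<omega>. indicator A \<omega> * g \<omega> * (Z i (T \<omega>) \<omega> - Z i (S \<omega>) \<omega>) \<partial>P) = 0"
        if g: "g \<in> borel_measurable (pre_sigma S)" "\<And>\<omega>. \<omega> \<in> A \<Longrightarrow> \<bar>g \<omega>\<bar> \<le> C" and C: "0 \<le> C" for g C i
      proof -
        have gA: "(\<lambda>\<omega>. indicator A \<omega> * g \<omega>) \<in> borel_measurable (pre_sigma S)"
          using g(1) A(1) by measurable
        have gC: "\<bar>indicator A \<omega> * g \<omega>\<bar> \<le> C" for \<omega> using g(2)[of \<omega>] C by (simp add: indicator_def)
        have supp: "ereal (T \<omega>) \<le> \<tau> i n \<omega> \<and> \<bar>Z i 0 \<omega>\<bar> \<le> (real n)\<^sup>2 + real n \<and>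
          \<bar>Z i (S \<omega>) \<omega>\<bar> \<le> (real n)\<^sup>2 + real n \<and> \<bar>Z i (T \<omega>) \<omega>\<bar> \<le> (real n)\<^sup>2 + real n"
          if "\<omega> \<in> space P" "indicator A \<omega> * g \<omega> \<noteq> 0" for \<omega>
        proof -
          have \<omega>: "\<omega> \<in> B n" using that A(2) by (auto simp: indicator_def split: if_splits)
          have "0 \<le> \<rho> n \<omega>" "S \<omega> \<le> \<rho> n \<omega>" "0 \<le> T \<omega>" using ST[OF that(1)] STK[OF that(1)] by auto
          then show ?thesis using ST[OF that(1)] STK[OF that(1)] by (intro conjI \<tau>_ge Z_le \<omega>) auto
        qed
        note L = local_martingale_increment[OF Zc \<tau> \<tau>_mart S T STK gA gC supp]
        show "integrable P (\<lambda>\<omega>. indicator A \<omega> * g \<omega> * (Z i (T \<omega>) \<omega> - Z i (S \<omega>) \<omega>))"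
          "(\<integral>\<omega>. indicator A \<omega> * g \<omega> * (Z i (T \<omega>) \<omega> - Z i (S \<omega>) \<omega>) \<partial>P) = 0"
          using L by simp_all
      qed
      have HmS: "(\<lambda>\<omega>. H \<omega> $ d) \<in> borel_measurable (pre_sigma S)" for d
        using ST by (intro pre_sigma_mono[OF \<sigma> S _ Hm]) auto
      have MmS: "(\<lambda>\<omega>. M (S \<omega>) \<omega> $ d) \<in> borel_measurable (pre_sigma S)" for d
        by (rule cont_adapted_at_stopping_time[OF Mc S S0])
      have H1: "\<bar>H \<omega> $ d\<bar> \<le> 1" if "\<omega> \<in> A" for \<omega> d
        using component_le_norm_cart[of "H \<omega>" d] B_supp(2)[of \<omega>] that A(2) by auto
      have HH: "\<bar>H \<omega> $ d * H \<omega> $ q\<bar> \<le> 1" if "\<omega> \<in> A" for \<omega> d q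
        using mult_mono[OF H1[OF that, of d] H1[OF that, of q]] by (simp add: abs_mult)
      have HHM: "\<bar>H \<omega> $ d * H \<omega> $ q * M (S \<omega>) \<omega> $ p\<bar> \<le> (real n)\<^sup>2 + real n" if "\<omega> \<in> A" for \<omega> d q p
      proof -
        have \<omega>: "\<omega> \<in> B n" using that A(2) by blast
        have "\<bar>M (S \<omega>) \<omega> $ p\<bar> \<le> (real n)\<^sup>2 + real n"
          using Z_le[OF \<omega>, of "S \<omega>" "(None, p)"] ST[OF B_supp(1)[OF \<omega>]] S0[OF B_supp(1)[OF \<omega>]] by (simp add: Z_simps)
        from mult_mono[OF HH[OF that, of d q] this] show ?thesis by (simp add: abs_mult)
      qed
      have ST': "max (S \<omega>) (\<sigma> \<omega>) = S \<omega>" "max (T \<omega>) (\<sigma> \<omega>) = T \<omega>" if "\<omega> \<in> space P" for \<omega>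
        using ST[OF that] by auto
      have "(\<integral>\<omega>. indicator A \<omega> * (?N (T \<omega>) \<omega> - ?N (S \<omega>) \<omega>) \<partial>P)
          = (\<integral>\<omega>. (\<Sum>d\<in>UNIV. indicator A \<omega> * H \<omega> $ d * (Z (None, d) (T \<omega>) \<omega> - Z (None, d) (S \<omega>) \<omega>)) \<partial>P)"
        by (rule Bochner_Integration.integral_cong)
           (simp_all add: projected_def ST' Z_simps sum_distrib_left sum_subtractf[symmetric] algebra_simps)
      also have "\<dots> = 0" using inc[OF HmS H1] by simp
      finally have 1: "(\<integral>\<omega>. indicator A \<omega> * (?N (T \<omega>) \<omega> - ?N (S \<omega>) \<omega>) \<partial>P) = 0" .
      \<comment> \<open>With increments from S to T, the product of those of M^d and M^q is the
        increment of M^d M^q minus M^d(S) times that of M^q minus M^q(S) times that of M^d. So each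
        term has a bounded coefficient known at S times an increment of a member of the family
        \<open>Z\<close>.\<close>
      define R where "R = (\<lambda>d q \<omega>.
          indicator A \<omega> * (H \<omega> $ d * H \<omega> $ q) * (Z (Some d, q) (T \<omega>) \<omega> - Z (Some d, q) (S \<omega>) \<omega>)
        - indicator A \<omega> * (H \<omega> $ d * H \<omega> $ q * M (S \<omega>) \<omega> $ d) * (Z (None, q) (T \<omega>) \<omega> - Z (None, q) (S \<omega>) \<omega>)
        - indicator A \<omega> * (H \<omega> $ d * H \<omega> $ q * M (S \<omega>) \<omega> $ q) * (Z (None, d) (T \<omega>) \<omega> - Z (None, d) (S \<omega>) \<omega>))"
      have R_int: "integrable P (R d q)" "(\<integral>\<omega>. R d q \<omega> \<partial>P) = 0" for d q
      proof -
        note m = borel_measurable_times[OF HmS HmS]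
        note i1 = inc[OF m HH, of d q "(Some d, q)"]
        note i2 = inc[OF borel_measurable_times[OF m MmS] HHM, of d q d "(None, q)"]
        note i3 = inc[OF borel_measurable_times[OF m MmS] HHM, of d q q "(None, d)"]
        show "integrable P (R d q)" unfolding R_def using i1 i2 i3 by (intro Bochner_Integration.integrable_diff) auto
        show "(\<integral>\<omega>. R d q \<omega> \<partial>P) = 0" unfolding R_def using i1 i2 i3 by simp
      qed
      have sq: "indicator A \<omega> * ((?N (T \<omega>) \<omega> - ?N (S \<omega>) \<omega>)\<^sup>2 - (?a (T \<omega>) \<omega> - ?a (S \<omega>) \<omega>)) = (\<Sum>d\<in>UNIV. \<Sum>q\<in>UNIV. R d q \<omega>)"
        if "\<omega> \<in> space P" for \<omega>
      proof -
        have N_inc: "?N (T \<omega>) \<omega> - ?N (S \<omega>) \<omega> = (\<Sum>d\<in>UNIV. H \<omega> $ d * (M (T \<omega>) \<omega> $ d - M (S \<omega>) \<omega> $ d))"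
          using ST'[OF that] by (simp add: projected_def sum_subtractf[symmetric] algebra_simps)
        have a_inc: "?a (T \<omega>) \<omega> - ?a (S \<omega>) \<omega>
            = (\<Sum>d\<in>UNIV. \<Sum>q\<in>UNIV. H \<omega> $ d * H \<omega> $ q * (Q (T \<omega>) \<omega> $ d $ q - Q (S \<omega>) \<omega> $ d $ q))"
          using ST'[OF that] by (simp add: projected_clock_def sum_subtractf[symmetric] algebra_simps)
        have "(?N (T \<omega>) \<omega> - ?N (S \<omega>) \<omega>)\<^sup>2 - (?a (T \<omega>) \<omega> - ?a (S \<omega>) \<omega>)
          = (\<Sum>d\<in>UNIV. \<Sum>q\<in>UNIV. H \<omega> $ d * (M (T \<omega>) \<omega> $ d - M (S \<omega>) \<omega> $ d) * (H \<omega> $ q * (M (T \<omega>) \<omega> $ q - M (S \<omega>) \<omega> $ q))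
              - H \<omega> $ d * H \<omega> $ q * (Q (T \<omega>) \<omega> $ d $ q - Q (S \<omega>) \<omega> $ d $ q))"
          unfolding N_inc a_inc power2_eq_square sum_product by (simp add: sum_subtractf)
        then have "indicator A \<omega> * ((?N (T \<omega>) \<omega> - ?N (S \<omega>) \<omega>)\<^sup>2 - (?a (T \<omega>) \<omega> - ?a (S \<omega>) \<omega>))
          = (\<Sum>d\<in>UNIV. \<Sum>q\<in>UNIV. indicator A \<omega> * (H \<omega> $ d * (M (T \<omega>) \<omega> $ d - M (S \<omega>) \<omega> $ d) * (H \<omega> $ q * (M (T \<omega>) \<omega> $ q - M (S \<omega>) \<omega> $ q))
              - H \<omega> $ d * H \<omega> $ q * (Q (T \<omega>) \<omega> $ d $ q - Q (S \<omega>) \<omega> $ d $ q)))"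
          by (simp add: sum_distrib_left)
        also have "\<dots> = (\<Sum>d\<in>UNIV. \<Sum>q\<in>UNIV. R d q \<omega>)"
          by (intro sum.cong refl) (simp add: R_def Z_simps algebra_simps)
        finally show ?thesis .
      qed
      have "(\<integral>\<omega>. indicator A \<omega> * ((?N (T \<omega>) \<omega> - ?N (S \<omega>) \<omega>)\<^sup>2 - (?a (T \<omega>) \<omega> - ?a (S \<omega>) \<omega>)) \<partial>P)
          = (\<integral>\<omega>. (\<Sum>d\<in>UNIV. \<Sum>q\<in>UNIV. R d q \<omega>) \<partial>P)"
        by (rule Bochner_Integration.integral_cong) (simp_all add: sq)
      also have "\<dots> = 0" using R_int by simp
      finally show "(\<integral>\<omega>. indicator A \<omega> * (?N (T \<omega>) \<omega> - ?N (S \<omega>) \<omega>) \<partial>P) = 0 \<and>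
        (\<integral>\<omega>. indicator A \<omega> * ((?N (T \<omega>) \<omega> - ?N (S \<omega>) \<omega>)\<^sup>2 - (?a (T \<omega>) \<omega> - ?a (S \<omega>) \<omega>)) \<partial>P) = 0"
        using 1 by blast
    qed (use \<sigma> \<rho> Nc ac before_start Bm in auto)
    show ?thesis
    proof (rule no_sqrt_bound[OF c])
      fix \<omega> t assume \<omega>: "\<omega> \<in> B n" and t: "\<sigma> \<omega> \<le> t" "t \<le> \<rho> n \<omega>"
      note * = B_supp[OF \<omega>]
      have t0: "0 \<le> t" using \<sigma>0[OF *(1)] t by simp
      have le: "t \<le> \<nu> \<omega>" using t *(3) by (simp add: \<kappa>_def)
      note fc' = cont_adaptedD(2)[OF fc *(1)]
      have "f t \<omega> \<le> 0"
      proof (cases "t = \<nu> \<omega>")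
        case True
        have "f 0 \<omega> = 0" using before_start[of 0 \<omega>] \<sigma>0[OF *(1)] by (simp add: f_def)
        then show ?thesis using True not_above_at_hit[where f=f, OF fc' K\<^sub>1(1)] by (simp add: \<nu>_def)
      next
        case False
        then show ?thesis using le not_above_before_hit[where f=f, OF fc' K\<^sub>1(1) t0] by (simp add: \<nu>_def)
      qed
      then show "?N t \<omega> \<le> c * sqrt (?a t \<omega>)" by (simp add: f_def)
    next
      fix \<omega> assume \<omega>: "\<omega> \<in> B n"
      note * = B_supp[OF \<omega>]
      obtain \<epsilon> where "0 < \<epsilon>" "\<epsilon> * (\<rho> n \<omega> - \<sigma> \<omega>) \<le> ?a (\<rho> n \<omega>) \<omega> - ?a (\<sigma> \<omega>) \<omega>"
        using clock[OF *(5)] *(3,4) \<kappa>_le[of n \<omega>] by (metis less_imp_le order_refl)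
      moreover have "0 < \<epsilon> * (\<rho> n \<omega> - \<sigma> \<omega>)" using \<open>0 < \<epsilon>\<close> *(4) by simp
      ultimately show "0 < ?a (\<rho> n \<omega>) \<omega>" using before_start(2)[of "\<sigma> \<omega>" \<omega>] by simp
    qed
  qed
  have B_AE: "AE \<omega> in P. \<forall>n. \<omega> \<notin> B n"
    unfolding AE_all_countable
  proof
    fix n
    have "B n \<in> sets P" using Bm[of n] subalgebra_pre_sigma[OF \<sigma>] by (auto simp: subalgebra_def)
    then have "B n \<in> null_sets P" using B_null[of n] by (simp add: null_sets_def emeasure_eq_measure)
    then show "AE \<omega> in P. \<omega> \<notin> B n" by (rule AE_not_in)
  qed
  have \<tau>_AE: "AE \<omega> in P. \<forall>i. (\<lambda>n. \<tau> i n \<omega>) \<longlonglongrightarrow> \<infinity>"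
    unfolding AE_all_countable using \<tau>_lim by blast
  show ?thesis
    using B_AE \<tau>_AE E(2) AE_space
  proof eventually_elim
    case (elim \<omega>)
    then have \<omega>: "\<omega> \<in> space P" by blast
    have "\<forall>\<^sub>F n in sequentially. \<forall>i. ereal K\<^sub>1 < \<tau> i n \<omega>"
    proof (rule eventually_all_finite)
      show "\<forall>\<^sub>F n in sequentially. ereal K\<^sub>1 < \<tau> i n \<omega>" for i
        by (rule order_tendstoD(1)[OF elim(2)[rule_format]]) simp
    qed
    then have 1: "\<forall>\<^sub>F n in sequentially. \<theta> n \<omega> = K\<^sub>1"
    proof eventually_elim
      case (elim n)
      then have "(\<lambda>i. real_of_ereal (min (ereal K\<^sub>1) (\<tau> i n \<omega>))) = (\<lambda>_. K\<^sub>1)"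
        by (simp add: fun_eq_iff min_absorb1 less_imp_le)
      then show ?case unfolding \<theta>_def by (simp only: image_constant_conv UNIV_not_empty if_False Min_singleton)
    qed
    have "compact ((\<lambda>t. U t \<omega>) ` {0..K\<^sub>1})"
      by (intro compact_continuous_image continuous_on_subset[OF cont_adaptedD(2)[OF Uc \<omega>]]) auto
    then obtain b where b: "\<And>t. 0 \<le> t \<Longrightarrow> t \<le> K\<^sub>1 \<Longrightarrow> U t \<omega> \<le> b"
      by (force dest!: compact_imp_bounded simp: bounded_real abs_le_iff)
    have "\<forall>\<^sub>F n in sequentially. b \<le> real n"
      by (rule eventually_at_top_linorderI[of "nat \<lceil>b\<rceil>"]) linarith
    then have 2: "\<forall>\<^sub>F n in sequentially. hit U (real n) K\<^sub>1 \<omega> = K\<^sub>1"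
    proof eventually_elim
      case (elim n)
      have "\<not> hit U (real n) K\<^sub>1 \<omega> < K\<^sub>1"
        using b elim by (subst hit_less_iff[OF K\<^sub>1(1)]) (force simp: not_less)
      then show ?case using hit_bounds(2)[OF K\<^sub>1(1), of U "real n" \<omega>] by simp
    qed
    from eventually_conj[OF 1 2] obtain n where n: "\<theta> n \<omega> = K\<^sub>1" "hit U (real n) K\<^sub>1 \<omega> = K\<^sub>1"
      by (auto dest: eventually_happens)
    \<comment> \<open>For this n both localizing bounds have reached the horizon, so
      \<open>\<kappa> n\<close> equals \<nu>, and \<omega> lying outside \<open>B n\<close> leaves
      only \<nu> \<le> \<sigma>.\<close>
    have "\<not> \<sigma> \<omega> < \<kappa> n \<omega>" using elim by (auto simp: B_def)
    then have \<nu>\<sigma>: "\<nu> \<omega> \<le> \<sigma> \<omega>" using n \<sigma>K[OF \<omega>] K\<^sub>1(2) by (auto simp: \<kappa>_def min_def split: if_splits)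
    show ?case
    proof (intro allI impI)
      fix \<eta> :: real assume "0 < \<eta>"
      then have "\<nu> \<omega> < min (\<sigma> \<omega> + \<eta>) K\<^sub>1" using \<nu>\<sigma> \<sigma>K[OF \<omega>] K\<^sub>1(2) by simp
      then obtain t where t: "t < min (\<sigma> \<omega> + \<eta>) K\<^sub>1" "0 < f t \<omega>"
        unfolding \<nu>_def hit_less_iff[OF K\<^sub>1(1)] by auto
      \<comment> \<open>f vanishes up to \<sigma>, so a time with f > 0 comes strictly
        later.\<close>
      then have "\<sigma> \<omega> < t" using before_start[of t \<omega>] by (auto simp: f_def not_le[symmetric])
      with t show "\<exists>t>\<sigma> \<omega>. t < \<sigma> \<omega> + \<eta> \<and> t < K + 1 \<and> c * sqrt (?a t \<omega>) < ?N t \<omega>"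
        by (auto simp: f_def K\<^sub>1_def)
    qed
  qed
qed

section \<open>Exceptional null sets and the crossing times\<close>

text \<open>Almost sure events lie in every \<open>F t\<close> with t \<ge> 0, so altering a process
  off such an event keeps it adapted. This is how almost surely continuous processes become
  \<open>cont_adapted\<close>.\<close>

lemma adapted_restrict:
  fixes Z :: "real \<Rightarrow> 'a \<Rightarrow> real"
  assumes "AE \<omega> in P. R \<omega>" "adapted F Z"
  shows "adapted F (\<lambda>t \<omega>. if \<omega> \<in> {\<omega> \<in> space P. R \<omega>} then Z t \<omega> else 0)"
  unfolding adapted_def
proof (intro allI impI)
  fix t :: real assume t: "0 \<le> t"
  have "{\<omega> \<in> space (F t). \<omega> \<in> {\<omega> \<in> space P. R \<omega>}} \<in> sets (F t)"
    using AE_imp_sets_F[OF assms(1) t] by (simp add: space_F)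
  moreover have "Z t \<in> borel_measurable (F t)" using assms(2) t by (simp add: adapted_def)
  ultimately show "(\<lambda>\<omega>. if \<omega> \<in> {\<omega> \<in> space P. R \<omega>} then Z t \<omega> else 0) \<in> borel_measurable (F t)"
    by (intro measurable_If) auto
qed

lemma martingale_restrict:
  assumes R: "AE \<omega> in P. R \<omega>" and Z: "martingale P F Z"
  shows "martingale P F (\<lambda>t \<omega>. if \<omega> \<in> {\<omega> \<in> space P. R \<omega>} then Z t \<omega> else 0)"
  unfolding martingale_def
proof (intro conjI allI impI)
  let ?Z = "\<lambda>t \<omega>. if \<omega> \<in> {\<omega> \<in> space P. R \<omega>} then Z t \<omega> else 0"
  show ad: "adapted F ?Z" using Z by (intro adapted_restrict R) (simp add: martingale_def)
  have meas: "?Z t \<in> borel_measurable P" "Z t \<in> borel_measurable P" if "0 \<le> t" for t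
    using ad Z that by (auto simp: adapted_def martingale_def intro: measurable_F_imp_P)
  have eq: "AE \<omega> in P. ?Z t \<omega> = Z t \<omega>" for t
    using R AE_space by eventually_elim simp
  show "integrable P (?Z t)" if "0 \<le> t" for t
    using Z that meas[OF that] eq[of t]
    by (subst integrable_cong_AE[of _ _ "Z t"]) (auto simp: martingale_def)
  fix s t :: real assume st: "0 \<le> s \<and> s \<le> t"
  interpret sub: finite_measure_subalgebra P "F s"
    by unfold_locales (rule subalgebra_F)
  have "AE \<omega> in P. real_cond_exp P (F s) (?Z t) \<omega> = real_cond_exp P (F s) (Z t) \<omega>"
    using st meas[of t] eq[of t] by (intro sub.real_cond_exp_cong) auto
  moreover have "AE \<omega> in P. real_cond_exp P (F s) (Z t) \<omega> = Z s \<omega>"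
    using Z st by (auto simp: martingale_def)
  ultimately show "AE \<omega> in P. real_cond_exp P (F s) (?Z t) \<omega> = ?Z s \<omega>"
    using eq[of s] by eventually_elim simp
qed

text \<open>Setting a process to 0 off an event commutes with stopping it and with subtracting its
  initial value, so the same localizing times work.\<close>

lemma continuous_local_martingale_restrict:
  assumes R: "AE \<omega> in P. R \<omega>" and Z: "continuous_local_martingale P F Z"
  shows "continuous_local_martingale P F (\<lambda>t \<omega>. if \<omega> \<in> {\<omega> \<in> space P. R \<omega>} then Z t \<omega> else 0)"
proof -
  let ?Z = "\<lambda>t \<omega>. if \<omega> \<in> {\<omega> \<in> space P. R \<omega>} then Z t \<omega> else 0"
  obtain \<tau> where \<tau>: "\<forall>n::nat. ext_stopping_time P F (\<tau> n)"
    "AE \<omega> in P. incseq (\<lambda>n. \<tau> n \<omega>) \<and> (\<lambda>n. \<tau> n \<omega>) \<longlonglongrightarrow> \<infinity>"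
    and V: "\<And>n. martingale P F (\<lambda>t \<omega>. stopped (\<tau> n) Z t \<omega> - Z 0 \<omega>)"
    using Z unfolding continuous_local_martingale_def by blast
  have "(\<lambda>t \<omega>. if \<omega> \<in> {\<omega> \<in> space P. R \<omega>} then stopped (\<tau> n) Z t \<omega> - Z 0 \<omega> else 0)
      = (\<lambda>t \<omega>. stopped (\<tau> n) ?Z t \<omega> - ?Z 0 \<omega>)" for n
    by (auto simp: fun_eq_iff stopped_def)
  with martingale_restrict[OF R V] have "\<forall>n. martingale P F (\<lambda>t \<omega>. stopped (\<tau> n) ?Z t \<omega> - ?Z 0 \<omega>)"
    by simp
  moreover have "adapted F ?Z"
    using Z by (intro adapted_restrict R) (simp add: continuous_local_martingale_def)
  moreover have "AE \<omega> in P. continuous_on {0..} (\<lambda>t. Z t \<omega>)"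
    using Z by (simp add: continuous_local_martingale_def)
  then have "AE \<omega> in P. continuous_on {0..} (\<lambda>t. ?Z t \<omega>)"
  proof eventually_elim
    case (elim \<omega>)
    then show ?case by (cases "\<omega> \<in> {\<omega> \<in> space P. R \<omega>}") auto
  qed
  ultimately show ?thesis using \<tau> unfolding continuous_local_martingale_def by blast
qed

lemma crossing_time_eq_start:
  fixes X M Y :: "real \<Rightarrow> 'a \<Rightarrow> real^'d" and Q :: "real \<Rightarrow> 'a \<Rightarrow> real^'d^'d"
  assumes X: "\<And>t \<omega>. 0 \<le> t \<Longrightarrow> \<omega> \<in> space P \<Longrightarrow> X t \<omega> = M t \<omega> + Y t \<omega>"
    and M: "\<And>d. continuous_local_martingale P F (\<lambda>t \<omega>. M t \<omega> $ d)"
    and Q: "\<And>d q. quadratic_covariation P F (\<lambda>t \<omega>. M t \<omega> $ d) (\<lambda>t \<omega>. M t \<omega> $ q) (\<lambda>t \<omega>. Q t \<omega> $ d $ q)"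
    and ell: "\<And>K::nat. AE \<omega> in P. \<exists>\<epsilon>>0. \<forall>s t. 0 \<le> s \<and> s \<le> t \<and> t \<le> real K \<longrightarrow>
              psd_le ((\<epsilon> * (t - s)) *\<^sub>R mat 1) (Q t \<omega> - Q s \<omega>)"
    and Y: "\<And>K::nat. AE \<omega> in P. \<exists>C>0. \<forall>s t. 0 \<le> s \<and> s \<le> t \<and> t \<le> real K \<longrightarrow>
              norm (Y t \<omega> - Y s \<omega>) \<le> C * \<bar>t - s\<bar> powr (1 / 2)"
    and \<sigma>: "stopping_time F \<sigma>" and \<sigma>K: "\<And>\<omega>. \<omega> \<in> space P \<Longrightarrow> 0 \<le> \<sigma> \<omega> \<and> \<sigma> \<omega> \<le> K"
    and H: "measurable_direction P F \<sigma> H"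
  shows "AE \<omega> in P. crossing_time X \<sigma> H \<omega> = ereal (\<sigma> \<omega>)"
proof -
  define L where "L = nat \<lceil>K\<rceil>"
  have L: "K \<le> real L" by (simp add: L_def real_nat_ceiling_ge)
  have \<sigma>L: "0 \<le> \<sigma> \<omega> \<and> \<sigma> \<omega> \<le> real L" if "\<omega> \<in> space P" for \<omega> using \<sigma>K[OF that] L by simp
  define R where "R = (\<lambda>\<omega>. (\<forall>d. continuous_on {0..} (\<lambda>t. M t \<omega> $ d)) \<and> (\<forall>d q. continuous_on {0..} (\<lambda>t. Q t \<omega> $ d $ q)))"
  have R: "AE \<omega> in P. R \<omega>"
    unfolding R_def AE_conj_iff AE_all_countable
    using M Q by (auto simp: continuous_local_martingale_def quadratic_covariation_def)
  let ?R = "{\<omega> \<in> space P. R \<omega>}"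
  define M' where "M' = (\<lambda>t \<omega>. if \<omega> \<in> ?R then M t \<omega> else 0)"
  define Q' where "Q' = (\<lambda>t \<omega>. if \<omega> \<in> ?R then Q t \<omega> else 0)"
  have M'_comp: "(\<lambda>t \<omega>. M' t \<omega> $ d) = (\<lambda>t \<omega>. if \<omega> \<in> ?R then M t \<omega> $ d else 0)" for d
    by (auto simp: M'_def fun_eq_iff)
  have Q'_comp: "(\<lambda>t \<omega>. Q' t \<omega> $ d $ q) = (\<lambda>t \<omega>. if \<omega> \<in> ?R then Q t \<omega> $ d $ q else 0)" for d q
    by (auto simp: Q'_def fun_eq_iff)
  have MQ'_comp: "(\<lambda>t \<omega>. M' t \<omega> $ d * M' t \<omega> $ q - Q' t \<omega> $ d $ q)
    = (\<lambda>t \<omega>. if \<omega> \<in> ?R then M t \<omega> $ d * M t \<omega> $ q - Q t \<omega> $ d $ q else 0)" for d q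
    by (auto simp: M'_def Q'_def fun_eq_iff)
  have M'c: "cont_adapted (\<lambda>t \<omega>. M' t \<omega> $ d)" for d
  proof -
    have "adapted F (\<lambda>t \<omega>. M' t \<omega> $ d)"
      unfolding M'_comp using M[of d] by (intro adapted_restrict R) (simp add: continuous_local_martingale_def)
    moreover have "continuous_on {0..} (\<lambda>t. M' t \<omega> $ d)" for \<omega>
    proof (cases "\<omega> \<in> ?R")
      case True
      then show ?thesis by (simp add: M'_def) (simp add: R_def)
    qed (auto simp: M'_def)
    ultimately show ?thesis by (simp add: cont_adapted_def)
  qed
  have Q'c: "cont_adapted (\<lambda>t \<omega>. Q' t \<omega> $ d $ q)" for d q
  proof -
    have "adapted F (\<lambda>t \<omega>. Q' t \<omega> $ d $ q)"
      unfolding Q'_comp using Q[of d q] by (intro adapted_restrict R) (simp add: quadratic_covariation_def)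
    moreover have "continuous_on {0..} (\<lambda>t. Q' t \<omega> $ d $ q)" for \<omega>
    proof (cases "\<omega> \<in> ?R")
      case True
      then show ?thesis by (simp add: Q'_def) (simp add: R_def)
    qed (auto simp: Q'_def)
    ultimately show ?thesis by (simp add: cont_adapted_def)
  qed
  have M'l: "continuous_local_martingale P F (\<lambda>t \<omega>. M' t \<omega> $ d)" for d
    unfolding M'_comp by (rule continuous_local_martingale_restrict[OF R M])
  have Q'l: "continuous_local_martingale P F (\<lambda>t \<omega>. M' t \<omega> $ d * M' t \<omega> $ q - Q' t \<omega> $ d $ q)" for d q
    unfolding MQ'_comp using Q[of d q]
    by (intro continuous_local_martingale_restrict[OF R]) (simp add: quadratic_covariation_def)
  have H': "H \<in> borel_measurable (pre_sigma \<sigma>)" "AE \<omega> in P. norm (H \<omega>) = 1"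
    using H by (auto simp: measurable_direction_def)
  have ell': "AE \<omega> in P. \<exists>\<epsilon>>0. \<forall>s t. 0 \<le> s \<and> s \<le> t \<and> t \<le> real L + 1 \<longrightarrow>
       psd_le ((\<epsilon> * (t - s)) *\<^sub>R mat 1) (Q' t \<omega> - Q' s \<omega>)"
    using ell[of "L + 1"] R AE_space by eventually_elim (simp add: Q'_def add.commute)
  \<comment> \<open>All natural c share one null set, since the factor needed below depends on the
    path.\<close>
  have exceeds: "AE \<omega> in P. \<forall>c::nat. \<forall>\<eta>>0. \<exists>t. \<sigma> \<omega> < t \<and> t < \<sigma> \<omega> + \<eta> \<and> t < real L + 1 \<and>
     real c * sqrt (projected_clock Q' \<sigma> H t \<omega>) < projected M' \<sigma> H t \<omega>"
    unfolding AE_all_countable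
    by (intro allI projected_exceeds_sqrt_clock[OF M'c Q'c M'l Q'l \<sigma> \<sigma>L _ H' ell']) auto
  show ?thesis
    using exceeds ell' Y[of "L + 1"] H'(2) R AE_space
  proof eventually_elim
    case (elim \<omega>)
    then have \<omega>: "\<omega> \<in> space P" by blast
    obtain \<epsilon> where \<epsilon>: "0 < \<epsilon>" "\<And>s t. 0 \<le> s \<Longrightarrow> s \<le> t \<Longrightarrow> t \<le> real L + 1 \<Longrightarrow>
        psd_le ((\<epsilon> * (t - s)) *\<^sub>R mat 1) (Q' t \<omega> - Q' s \<omega>)" using elim(2) by blast
    obtain C where C: "0 < C" "\<And>s t. 0 \<le> s \<Longrightarrow> s \<le> t \<Longrightarrow> t \<le> real L + 1 \<Longrightarrow>
        norm (Y t \<omega> - Y s \<omega>) \<le> C * \<bar>t - s\<bar> powr (1 / 2)" using elim(3) by force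
    \<comment> \<open>The factor for which c sqrt a, with a \<ge> \<epsilon> (t - \<sigma>),
      dominates the bound C sqrt (t - \<sigma>) on the increment of Y.\<close>
    obtain c :: nat where "C / sqrt \<epsilon> \<le> real c" using real_arch_simple by blast
    then have c: "C \<le> real c * sqrt \<epsilon>" using \<epsilon>(1) by (simp add: pos_divide_le_eq)
    have cross: "\<exists>t. \<sigma> \<omega> < t \<and> t < \<sigma> \<omega> + \<eta> \<and> 0 < H \<omega> \<bullet> (X t \<omega> - X (\<sigma> \<omega>) \<omega>)" if "0 < \<eta>" for \<eta>
    proof -
      obtain t where t: "\<sigma> \<omega> < t" "t < \<sigma> \<omega> + \<eta>" "t < real L + 1"
        "real c * sqrt (projected_clock Q' \<sigma> H t \<omega>) < projected M' \<sigma> H t \<omega>"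
        using elim(1) \<open>0 < \<eta>\<close> by blast
      have \<sigma>0: "0 \<le> \<sigma> \<omega>" using \<sigma>L[OF \<omega>] by simp
      have "projected_clock Q' \<sigma> H (\<sigma> \<omega>) \<omega> = 0" by (simp add: projected_clock_def)
      moreover have "\<epsilon> * (t - \<sigma> \<omega>) \<le> projected_clock Q' \<sigma> H t \<omega> - projected_clock Q' \<sigma> H (\<sigma> \<omega>) \<omega>"
        using t \<sigma>0 elim(4) by (intro projected_clock_increment_ge \<epsilon>(2)) auto
      ultimately have "sqrt (\<epsilon> * (t - \<sigma> \<omega>)) \<le> sqrt (projected_clock Q' \<sigma> H t \<omega>)" by simp
      then have "real c * (sqrt \<epsilon> * sqrt (t - \<sigma> \<omega>)) \<le> real c * sqrt (projected_clock Q' \<sigma> H t \<omega>)"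
        by (intro mult_left_mono) (auto simp: real_sqrt_mult)
      moreover have "C * sqrt (t - \<sigma> \<omega>) \<le> real c * sqrt \<epsilon> * sqrt (t - \<sigma> \<omega>)"
        using c t(1) by (intro mult_right_mono) auto
      moreover have "norm (Y t \<omega> - Y (\<sigma> \<omega>) \<omega>) \<le> C * sqrt (t - \<sigma> \<omega>)"
        using C(2)[of "\<sigma> \<omega>" t] t(1,3) \<sigma>0 by (simp add: powr_half_sqrt)
      moreover have "\<bar>H \<omega> \<bullet> (Y t \<omega> - Y (\<sigma> \<omega>) \<omega>)\<bar> \<le> norm (Y t \<omega> - Y (\<sigma> \<omega>) \<omega>)"
        using Cauchy_Schwarz_ineq2[of "H \<omega>" "Y t \<omega> - Y (\<sigma> \<omega>) \<omega>"] elim(4) by simp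
      moreover have "projected M' \<sigma> H t \<omega> = H \<omega> \<bullet> (M t \<omega> - M (\<sigma> \<omega>) \<omega>)"
        using t(1) elim(5) \<omega> by (subst projected_eq_inner) (auto simp: M'_def)
      ultimately have "0 < H \<omega> \<bullet> (M t \<omega> - M (\<sigma> \<omega>) \<omega>) + H \<omega> \<bullet> (Y t \<omega> - Y (\<sigma> \<omega>) \<omega>)"
        using t(4) by (simp add: mult.assoc)
      also have "\<dots> = H \<omega> \<bullet> (X t \<omega> - X (\<sigma> \<omega>) \<omega>)"
        using X[OF _ \<omega>, of t] X[OF _ \<omega>, of "\<sigma> \<omega>"] \<sigma>0 t(1) by (simp add: inner_diff_right inner_add_right)
      finally show ?thesis using t by blast
    qed
    show ?case
    proof (rule antisym)
      show "ereal (\<sigma> \<omega>) \<le> crossing_time X \<sigma> H \<omega>"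
        unfolding crossing_time_def by (rule Inf_greatest) auto
      show "crossing_time X \<sigma> H \<omega> \<le> ereal (\<sigma> \<omega>)"
      proof (rule ereal_le_epsilon2)
        fix \<eta> :: real assume "0 < \<eta>"
        then obtain t where "\<sigma> \<omega> < t" "t < \<sigma> \<omega> + \<eta>" "0 < H \<omega> \<bullet> (X t \<omega> - X (\<sigma> \<omega>) \<omega>)" using cross by blast
        then show "crossing_time X \<sigma> H \<omega> \<le> ereal (\<sigma> \<omega>) + ereal \<eta>"
          unfolding crossing_time_def by (intro Inf_lower2[of "ereal t"]) auto
      qed
    qed
  qed
qed

end

theorem theorem3p5:
  fixes P :: "'a measure" and F :: "real \<Rightarrow> 'a measure"
    and X M Y :: "real \<Rightarrow> 'a \<Rightarrow> real^'d" and Q :: "real \<Rightarrow> 'a \<Rightarrow> real^'d^'d"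
  assumes "usual_filtered_prob_space P F"
    and "\<And>t \<omega>. 0 \<le> t \<Longrightarrow> \<omega> \<in> space P \<Longrightarrow> X t \<omega> = M t \<omega> + Y t \<omega>"
    and "\<And>d. continuous_local_martingale P F (\<lambda>t \<omega>. M t \<omega> $ d)"
    and "adapted F Y"
    and "\<And>d q. quadratic_covariation P F (\<lambda>t \<omega>. M t \<omega> $ d) (\<lambda>t \<omega>. M t \<omega> $ q) (\<lambda>t \<omega>. Q t \<omega> $ d $ q)"
    and "\<And>K::nat. \<exists>\<epsilon>\<in>borel_measurable P. AE \<omega> in P. 0 < \<epsilon> \<omega> \<and>
           (\<forall>s t. 0 \<le> s \<and> s \<le> t \<and> t \<le> real K \<longrightarrow>
              psd_le ((\<epsilon> \<omega> * (t - s)) *\<^sub>R mat 1) (Q t \<omega> - Q s \<omega>))"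
    and "\<And>K::nat. \<exists>C\<in>borel_measurable P. AE \<omega> in P. (0::real) < C \<omega> \<and>
           (\<forall>s t. 0 \<le> s \<and> s \<le> t \<and> t \<le> real K \<longrightarrow>
              norm (Y t \<omega> - Y s \<omega>) \<le> C \<omega> * \<bar>t - s\<bar> powr (1 / 2))"
  shows "twc_at_bounded_stopping_times P F X"
  unfolding twc_at_bounded_stopping_times_def
proof (intro allI impI)
  interpret usual_filtered_prob_space P F by (rule assms(1))
  have ell: "AE \<omega> in P. \<exists>\<epsilon>>0. \<forall>s t. 0 \<le> s \<and> s \<le> t \<and> t \<le> real K \<longrightarrow>
      psd_le ((\<epsilon> * (t - s)) *\<^sub>R mat 1) (Q t \<omega> - Q s \<omega>)" for K
  proof -
    obtain \<epsilon> where "AE \<omega> in P. 0 < \<epsilon> \<omega> \<and> (\<forall>s t. 0 \<le> s \<and> s \<le> t \<and> t \<le> real K \<longrightarrow>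
      psd_le ((\<epsilon> \<omega> * (t - s)) *\<^sub>R mat 1) (Q t \<omega> - Q s \<omega>))" using assms(6)[of K] by blast
    then show ?thesis by eventually_elim blast
  qed
  have hoelder: "AE \<omega> in P. \<exists>C>0. \<forall>s t. 0 \<le> s \<and> s \<le> t \<and> t \<le> real K \<longrightarrow>
      norm (Y t \<omega> - Y s \<omega>) \<le> C * \<bar>t - s\<bar> powr (1 / 2)" for K
  proof -
    obtain C where "AE \<omega> in P. (0::real) < C \<omega> \<and> (\<forall>s t. 0 \<le> s \<and> s \<le> t \<and> t \<le> real K \<longrightarrow>
      norm (Y t \<omega> - Y s \<omega>) \<le> C \<omega> * \<bar>t - s\<bar> powr (1 / 2))" using assms(7)[of K] by blast
    then show ?thesis by eventually_elim blast
  qed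
  fix \<sigma> :: "'a \<Rightarrow> real" and H :: "'a \<Rightarrow> real^'d"
  assume *: "stopping_time F \<sigma> \<and> (\<exists>K. \<forall>\<omega>\<in>space P. 0 \<le> \<sigma> \<omega> \<and> \<sigma> \<omega> \<le> K) \<and> measurable_direction P F \<sigma> H"
  then obtain K where K: "\<And>\<omega>. \<omega> \<in> space P \<Longrightarrow> 0 \<le> \<sigma> \<omega> \<and> \<sigma> \<omega> \<le> K" by blast
  have at_start: "AE \<omega> in P. crossing_time X \<sigma> G \<omega> = ereal (\<sigma> \<omega>)" if "measurable_direction P F \<sigma> G" for G
    using * that by (intro crossing_time_eq_start[OF assms(2,3,5) ell hoelder _ K]) auto
  have "measurable_direction P F \<sigma> (\<lambda>\<omega>. - H \<omega>)"
    using * by (auto simp: measurable_direction_def)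
  from at_start[OF this] at_start[of H] * show
    "AE \<omega> in P. crossing_time X \<sigma> H \<omega> = crossing_time X \<sigma> (\<lambda>\<omega>. - H \<omega>) \<omega>"
    by (auto elim: AE_mp)
qed

end
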